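(* Assume $W$ is continuous and $\|W\|_\infty<\infty$. Then the minimum energy map $\kappa\mapsto m(\kappa)$ and the set map of minimizers $\kappa\mapsto M(\kappa)$, $\kappa>0$, satisfy the following. (i) For every $\kappa>0$, $M(\kappa)$ is non-empty and compact in $L^1(\mathbb{S}^1)$. Moreover, if $\kappa_n\to\kappa^\circ$ in $(0,\infty)$ and $\rho_{\kappa_n}\in M(\kappa_n)$, then there exist a subsequence $\{n_j\}$ and $\rho^\circ\in M(\kappa^\circ)$ such that $\rho_{\kappa_{n_j}}\to\rho^\circ$ in $L^1(\mathbb{S}^1)$. (ii) The map $\kappa\mapsto m(\kappa)$ is concave and globally Lipschitz. Its left and right derivatives $m'_-,m'_+$ exist for all $\kappa>0$ and satisfy $$m'_-(\kappa)=-\frac12\inf_{\rho\in M(\kappa)}\mathcal{E}(\rho,\rho),\qquad m'_+(\kappa)=-\frac12\sup_{\rho\in M(\kappa)}\mathcal{E}(\rho,\rho).$$ The maps $\kappa\mapsto\inf_{\rho\in M(\kappa)}\mathcal{E}(\rho,\rho)$ and $\kappa\mapsto\sup_{\rho\in M(\kappa)}\mathcal{E}(\rho,\rho)$ are non-decreasing in $\kappa$. (iii) There are at most countably many points of non-differentiability of $\kappa\mapsto m(\kappa)$. At such a point $\kappa$, $M(\kappa)$ has at least two elements, which both minimize the free energy but have different values of the interaction energy $\mathcal{E}(\rho,\rho)$.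
   Context: $\mathbb{S}^1=[0,2\pi)$ is the circle. $W:\mathbb{S}^1\to\mathbb{R}$ is even and square integrable with Fourier expansion $W(\theta)=\sum_{\ell=1}^\infty a_\ell\cos\ell\theta$. $\mathcal{P}^+_{ac}(\mathbb{S}^1)$ is the set of absolutely continuous probability measures on $\mathbb{S}^1$ with strictly positive density, identified with their densities $\rho$ w.r.t. $d\theta/2\pi$ (so $\frac1{2\pi}\int_0^{2\pi}\rho\,d\theta=1$). The interaction energy is $\mathcal{E}(\rho,\rho)=\frac1{4\pi^2}\int_0^{2\pi}\int_0^{2\pi}W(\theta-\phi)\rho(\theta)\rho(\phi)\,d\theta\,d\phi$ and the free energy is $\mathcal{F}(\rho,\kappa)=\frac1{2\pi}\int_0^{2\pi}\rho\log\rho\,d\theta-\frac\kappa2\mathcal{E}(\rho,\rho)$. For $\kappa>0$, $$m(\kappa)=\inf_{\rho\in\mathcal{P}^+_{ac}(\mathbb{S}^1)}\mathcal{F}(\rho,\kappa),\qquad M(\kappa)=\{\rho\in\mathcal{P}^+_{ac}(\mathbb{S}^1):\mathcal{F}(\rho,\kappa)=m(\kappa)\}.$$ *)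

theory Defs
  imports "HOL-Probability.Probability"
begin

text \<open>The circle \<open>[0, 2\<pi>)\<close> with the normalised measure \<open>d\<theta> / 2\<pi>\<close>. Functions on the circle are
  Borel functions on \<open>\<real>\<close>; their values off \<open>[0, 2\<pi>)\<close> are irrelevant almost everywhere.\<close>

definition circle :: "real measure"
  where "circle = uniform_measure lborel {0..<2 * pi}"

text \<open>The space \<open>L\<^sup>1\<close> of the circle: integrable functions modulo equality almost everywhere, with
  the distance \<open>\<parallel>f - g\<parallel>\<^sub>1\<close>.\<close>

definition L1_rel :: "(real \<Rightarrow> real) \<Rightarrow> (real \<Rightarrow> real) \<Rightarrow> bool"
  where "L1_rel f g \<longleftrightarrow>
    integrable circle f \<and> integrable circle g \<and> (AE \<theta> in circle. f \<theta> = g \<theta>)"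

quotient_type circle_L1 = "real \<Rightarrow> real" / partial: L1_rel
proof (rule part_equivpI)
  show "\<exists>f. L1_rel f f"
    by (rule exI[of _ "\<lambda>_. 0"]) (simp add: L1_rel_def)
  show "symp L1_rel"
    by (auto simp: symp_def L1_rel_def)
  show "transp L1_rel"
    unfolding transp_def L1_rel_def by (auto elim: eventually_elim2)
qed

instantiation circle_L1 :: metric_space
begin

lift_definition dist_circle_L1 :: "circle_L1 \<Rightarrow> circle_L1 \<Rightarrow> real"
  is "\<lambda>f g. LINT \<theta>|circle. \<bar>f \<theta> - g \<theta>\<bar>"
proof -
  fix f f' g g' :: "real \<Rightarrow> real"
  assume f: "L1_rel f f'" and g: "L1_rel g g'"
  show "(LINT \<theta>|circle. \<bar>f \<theta> - g \<theta>\<bar>) = (LINT \<theta>|circle. \<bar>f' \<theta> - g' \<theta>\<bar>)"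
  proof (rule integral_cong_AE)
    have "AE \<theta> in circle. f \<theta> = f' \<theta>" "AE \<theta> in circle. g \<theta> = g' \<theta>"
      using f g by (simp_all add: L1_rel_def)
    then show "AE \<theta> in circle. \<bar>f \<theta> - g \<theta>\<bar> = \<bar>f' \<theta> - g' \<theta>\<bar>"
      by eventually_elim simp
  qed (use f g in \<open>auto simp: L1_rel_def\<close>)
qed

definition uniformity_circle_L1 :: "(circle_L1 \<times> circle_L1) filter"
  where "uniformity_circle_L1 = (INF e\<in>{0<..}. principal {(x, y). dist x y < e})"

definition open_circle_L1 :: "circle_L1 set \<Rightarrow> bool"
  where "open_circle_L1 U \<longleftrightarrow> (\<forall>x\<in>U. \<forall>\<^sub>F (x', y) in uniformity. x' = x \<longrightarrow> y \<in> U)"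

instance
proof
  fix x y z :: circle_L1
  show "dist x y = 0 \<longleftrightarrow> x = y"
  proof transfer
    fix f g :: "real \<Rightarrow> real"
    assume "L1_rel f f" "L1_rel g g"
    then have int: "integrable circle f" "integrable circle g"
      by (simp_all add: L1_rel_def)
    then have "(LINT \<theta>|circle. \<bar>f \<theta> - g \<theta>\<bar>) = 0 \<longleftrightarrow> (AE \<theta> in circle. \<bar>f \<theta> - g \<theta>\<bar> = 0)"
      by (intro integral_nonneg_eq_0_iff_AE) auto
    with int show "(LINT \<theta>|circle. \<bar>f \<theta> - g \<theta>\<bar>) = 0 \<longleftrightarrow> L1_rel f g"
      by (simp add: L1_rel_def)
  qed
  show "dist x y \<le> dist x z + dist y z"
  proof transfer
    fix f g h :: "real \<Rightarrow> real"
    assume "L1_rel f f" "L1_rel g g" "L1_rel h h"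
    then have int: "integrable circle f" "integrable circle g" "integrable circle h"
      by (simp_all add: L1_rel_def)
    have "(LINT \<theta>|circle. \<bar>f \<theta> - g \<theta>\<bar>) \<le> (LINT \<theta>|circle. \<bar>f \<theta> - h \<theta>\<bar> + \<bar>g \<theta> - h \<theta>\<bar>)"
      using int by (intro integral_mono) auto
    also have "\<dots> = (LINT \<theta>|circle. \<bar>f \<theta> - h \<theta>\<bar>) + (LINT \<theta>|circle. \<bar>g \<theta> - h \<theta>\<bar>)"
      using int by (intro Bochner_Integration.integral_add) auto
    finally show "(LINT \<theta>|circle. \<bar>f \<theta> - g \<theta>\<bar>)
        \<le> (LINT \<theta>|circle. \<bar>f \<theta> - h \<theta>\<bar>) + (LINT \<theta>|circle. \<bar>g \<theta> - h \<theta>\<bar>)" .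
  qed
qed (simp_all add: uniformity_circle_L1_def open_circle_L1_def)

end

text \<open>Absolutely continuous probability measures with strictly positive density, identified with
  their densities with respect to \<open>d\<theta> / 2\<pi>\<close>.\<close>

definition pos_densities :: "circle_L1 set"
  where "pos_densities =
    {\<rho>. (AE \<theta> in circle. 0 < rep_circle_L1 \<rho> \<theta>) \<and> (LINT \<theta>|circle. rep_circle_L1 \<rho> \<theta>) = 1}"

text \<open>The potential \<open>W\<close> is a \<open>2\<pi>\<close>-periodic function on \<open>\<real>\<close>, so that \<open>W (\<theta> - \<phi>)\<close> makes sense.\<close>

definition interaction_energy :: "(real \<Rightarrow> real) \<Rightarrow> circle_L1 \<Rightarrow> real"
  where "interaction_energy W \<rho> =
    (LINT \<theta>|circle. LINT \<phi>|circle. W (\<theta> - \<phi>) * rep_circle_L1 \<rho> \<theta> * rep_circle_L1 \<rho> \<phi>)"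

text \<open>As \<open>x ln x \<ge> - 1 / e\<close>, the integral of \<open>\<rho> ln \<rho>\<close> is \<open>\<infinity>\<close> if \<open>\<rho> ln \<rho>\<close> is not integrable; the
  Bochner integral would give \<open>0\<close> there.\<close>

definition entropy_term :: "circle_L1 \<Rightarrow> ereal"
  where "entropy_term \<rho> =
    (if integrable circle (\<lambda>\<theta>. rep_circle_L1 \<rho> \<theta> * ln (rep_circle_L1 \<rho> \<theta>))
     then ereal (LINT \<theta>|circle. rep_circle_L1 \<rho> \<theta> * ln (rep_circle_L1 \<rho> \<theta>))
     else \<infinity>)"

definition free_energy :: "(real \<Rightarrow> real) \<Rightarrow> circle_L1 \<Rightarrow> real \<Rightarrow> ereal"
  where "free_energy W \<rho> \<kappa> = entropy_term \<rho> - ereal (\<kappa> / 2 * interaction_energy W \<rho>)"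

definition min_energy :: "(real \<Rightarrow> real) \<Rightarrow> real \<Rightarrow> ereal"
  where "min_energy W \<kappa> = (INF \<rho>\<in>pos_densities. free_energy W \<rho> \<kappa>)"

definition minimizers :: "(real \<Rightarrow> real) \<Rightarrow> real \<Rightarrow> circle_L1 set"
  where "minimizers W \<kappa> = {\<rho> \<in> pos_densities. free_energy W \<rho> \<kappa> = min_energy W \<kappa>}"

end

theory Submission
  imports Defs "HOL-Complex_Analysis.Great_Picard"
begin

text \<open>Every near-minimizer is almost a Gibbs density, and Gibbs densities of bounded
  equicontinuous potentials form a precompact set.

  Write \<open>V = W * \<rho>\<close> for the potential generated by a density \<open>\<rho>\<close> and \<open>\<sigma> = exp (\<kappa> V) / Z\<close> for the
  Gibbs density of that potential. The mixture \<open>(1 - t) \<rho> + t \<sigma>\<close> has free energy at most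
  \<open>F(\<rho>) - t H(\<rho>|\<sigma>) + C t\<^sup>2\<close>, where \<open>H\<close> is the relative entropy: the entropy is convex, and the
  quadratic form of the interaction is bounded. If \<open>\<rho>\<close> minimizes up to
  \<open>t\<^sup>2\<close>, it follows that \<open>H(\<rho>|\<sigma>)\<close> is of order \<open>t\<close> (\<open>relative_entropy_le_gap\<close>), hence
  \<open>\<rho>\<close> and \<open>\<sigma>\<close> are close in \<open>L\<^sup>1\<close> by a Pinsker-type inequality (\<open>L1_dist_gibbs_le\<close>).

  Now let \<open>\<rho>\<^sub>n\<close> minimize up to \<open>t\<^sub>n\<^sup>2 \<longlonglongrightarrow> 0\<close> at parameters \<open>\<kappa>\<^sub>n \<longlonglongrightarrow> \<kappa>\<close>. As \<open>W\<close> is uniformly continuous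
  on compact sets, the potentials \<open>V\<^sub>n\<close> are bounded and equicontinuous, and by the theorem of Arzela and
  Ascoli a subsequence converges. Then the Gibbs densities converge in \<open>L\<^sup>1\<close> by
  dominated convergence, hence so do the \<open>\<rho>\<^sub>n\<close>. The interaction energy is continuous in \<open>L\<^sup>1\<close>, and
  the entropies converge because the relative entropies vanish in the limit, so the limit is a
  minimizer at \<open>\<kappa>\<close> (\<open>near_minimizers_precompact\<close>). This yields existence, compactness and the
  convergence of subsequences of minimizers at once.

  The claims about \<open>m(\<kappa>)\<close> are an envelope theorem for an infimum of functions affine in \<open>\<kappa>\<close>
  (\<open>parametric_minimization\<close>). Such an infimum is concave, and
  Lipschitz since the slopes are bounded. Testing each of two
  minimizers at the parameter of the other squeezes the difference quotients of \<open>m\<close> between their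
  energies, which therefore increase with \<open>\<kappa>\<close>; the convergence of minimizers identifies
  the limits of the quotients. The intervals between the least and the greatest energy of
  a minimizer are disjoint for distinct \<open>\<kappa>\<close>, so only countably many are nondegenerate, and \<open>m\<close> is
  differentiable wherever the interval is a point.\<close>

section \<open>Envelope theorem for minima of affine functions of a parameter\<close>

text \<open>An envelope theorem. A minimum of functions affine in the parameter \<open>\<kappa>\<close> has one-sided
  derivatives given by the extreme slopes \<open>- E \<rho> / 2\<close> over the minimizers, once the set of minimizers
  depends on \<open>\<kappa>\<close> in a closed and compact way. Here \<open>X\<close> is the set of competitors, \<open>S - \<kappa> / 2 * E\<close> the
  functional, \<open>m\<close> its minimum and \<open>M\<close> its set of minimizers.\<close>

locale parametric_minimization =
  fixes X :: "'a set" and S E :: "'a \<Rightarrow> real" and B :: real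
    and m :: "real \<Rightarrow> real" and M :: "real \<Rightarrow> 'a set"
  assumes E_bound: "\<rho> \<in> X \<Longrightarrow> \<bar>E \<rho>\<bar> \<le> B"
    and M_subset: "0 < \<kappa> \<Longrightarrow> M \<kappa> \<subseteq> X"
    and m_le: "0 < \<kappa> \<Longrightarrow> \<rho> \<in> X \<Longrightarrow> m \<kappa> \<le> S \<rho> - \<kappa> / 2 * E \<rho>"
    and m_eq: "0 < \<kappa> \<Longrightarrow> \<rho> \<in> M \<kappa> \<Longrightarrow> m \<kappa> = S \<rho> - \<kappa> / 2 * E \<rho>"
    and M_nonempty: "0 < \<kappa> \<Longrightarrow> M \<kappa> \<noteq> {}"
    and M_closed: "\<lbrakk>\<And>n. 0 < \<kappa>s n; 0 < \<kappa>0; \<kappa>s \<longlonglongrightarrow> \<kappa>0; \<And>n. \<rho>s n \<in> M (\<kappa>s n)\<rbrakk>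
      \<Longrightarrow> \<exists>r \<rho>0. strict_mono (r :: nat \<Rightarrow> nat) \<and> \<rho>0 \<in> M \<kappa>0 \<and> (\<lambda>j. E (\<rho>s (r j))) \<longlonglongrightarrow> E \<rho>0"
begin

abbreviation "E_min \<kappa> \<equiv> INF \<rho>\<in>M \<kappa>. E \<rho>"
abbreviation "E_max \<kappa> \<equiv> SUP \<rho>\<in>M \<kappa>. E \<rho>"

lemma energies_bounded:
  assumes "0 < \<kappa>" shows "bdd_below (E ` M \<kappa>)" "bdd_above (E ` M \<kappa>)"
proof -
  have "- B \<le> E \<rho> \<and> E \<rho> \<le> B" if "\<rho> \<in> M \<kappa>" for \<rho>
    using E_bound M_subset[OF assms] that by (meson abs_le_D1 abs_le_D2 minus_le_iff subsetD)
  then show "bdd_below (E ` M \<kappa>)" "bdd_above (E ` M \<kappa>)"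
    by (auto intro!: bdd_belowI[of _ "- B"] bdd_aboveI[of _ B])
qed

lemma E_between:
  assumes "0 < \<kappa>" "\<rho> \<in> M \<kappa>" shows "E_min \<kappa> \<le> E \<rho>" "E \<rho> \<le> E_max \<kappa>"
  using assms energies_bounded by (auto intro: cINF_lower cSUP_upper)

lemma E_min_le_E_max: "0 < \<kappa> \<Longrightarrow> E_min \<kappa> \<le> E_max \<kappa>"
  using M_nonempty E_between by (meson ex_in_conv order_trans)

text \<open>Testing each of two minimizers at the parameter of the other bounds the increment of \<open>m\<close>
  by the two energies. Monotonicity of the energies and both one-sided derivatives rest on this.\<close>

lemma increment_bounds:
  assumes "0 < \<kappa>" "0 < \<kappa>'" "\<rho> \<in> M \<kappa>" "\<rho>' \<in> M \<kappa>'"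
  shows "m \<kappa>' - m \<kappa> \<le> - (\<kappa>' - \<kappa>) / 2 * E \<rho>" and "- (\<kappa>' - \<kappa>) / 2 * E \<rho>' \<le> m \<kappa>' - m \<kappa>"
proof -
  have X: "\<rho> \<in> X" "\<rho>' \<in> X"
    using assms M_subset by blast+
  show "m \<kappa>' - m \<kappa> \<le> - (\<kappa>' - \<kappa>) / 2 * E \<rho>"
    using m_le[OF assms(2) X(1)] m_eq[OF assms(1,3)] by (simp add: field_simps)
  show "- (\<kappa>' - \<kappa>) / 2 * E \<rho>' \<le> m \<kappa>' - m \<kappa>"
    using m_le[OF assms(1) X(2)] m_eq[OF assms(2,4)] by (simp add: field_simps)
qed

text \<open>The same bounds for the difference quotient, which is squeezed between energies at its two
  ends.\<close>

lemma slope_bounds: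
  assumes "0 < \<kappa>" "\<kappa> < \<kappa>'" "\<rho> \<in> M \<kappa>" "\<rho>' \<in> M \<kappa>'"
  shows "E \<rho> \<le> - 2 * ((m \<kappa>' - m \<kappa>) / (\<kappa>' - \<kappa>))" and "- 2 * ((m \<kappa>' - m \<kappa>) / (\<kappa>' - \<kappa>)) \<le> E \<rho>'"
proof -
  define c q where "c = \<kappa>' - \<kappa>" and "q = (m \<kappa>' - m \<kappa>) / (\<kappa>' - \<kappa>)"
  have c: "0 < c" and q: "m \<kappa>' - m \<kappa> = c * q"
    using assms(2) by (simp_all add: c_def q_def)
  have "m \<kappa>' - m \<kappa> \<le> - c / 2 * E \<rho>" "- c / 2 * E \<rho>' \<le> m \<kappa>' - m \<kappa>"
    using increment_bounds[OF assms(1) _ assms(3,4)] assms(1,2) unfolding c_def by linarith+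
  then have "c * E \<rho> \<le> c * (- 2 * q)" "c * (- 2 * q) \<le> c * E \<rho>'"
    unfolding q by simp_all
  then show "E \<rho> \<le> - 2 * ((m \<kappa>' - m \<kappa>) / (\<kappa>' - \<kappa>))" "- 2 * ((m \<kappa>' - m \<kappa>) / (\<kappa>' - \<kappa>)) \<le> E \<rho>'"
    using c unfolding q_def[symmetric] by (simp_all only: mult_le_cancel_left_pos)
qed

lemma energies_increase:
  assumes "0 < \<kappa>" "\<kappa> < \<kappa>'" "\<rho> \<in> M \<kappa>" "\<rho>' \<in> M \<kappa>'"
  shows "E \<rho> \<le> E \<rho>'"
proof -
  have "- (\<kappa>' - \<kappa>) / 2 * E \<rho>' \<le> - (\<kappa>' - \<kappa>) / 2 * E \<rho>"
    using increment_bounds[OF assms(1) _ assms(3,4)] assms(1,2) by linarith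
  then show ?thesis
    using assms(2) by simp
qed

lemma E_max_le_E_min:
  assumes "0 < \<kappa>" "\<kappa> < \<kappa>'" shows "E_max \<kappa> \<le> E_min \<kappa>'"
proof (rule cINF_greatest)
  fix \<rho>' assume "\<rho>' \<in> M \<kappa>'"
  then show "E_max \<kappa> \<le> E \<rho>'"
    using assms M_nonempty by (intro cSUP_least) (auto intro: energies_increase)
qed (use assms M_nonempty[of \<kappa>'] in auto)

lemma mono_E_min: "mono_on {0<..} E_min" and mono_E_max: "mono_on {0<..} E_max"
proof -
  have "E_min \<kappa> \<le> E_min \<kappa>' \<and> E_max \<kappa> \<le> E_max \<kappa>'" if "0 < \<kappa>" "\<kappa> \<le> \<kappa>'" for \<kappa> \<kappa>'
  proof (cases "\<kappa> = \<kappa>'")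
    case False
    then show ?thesis
      using that E_max_le_E_min[of \<kappa> \<kappa>'] E_min_le_E_max[of \<kappa>] E_min_le_E_max[of \<kappa>'] by linarith
  qed simp
  then show "mono_on {0<..} E_min" "mono_on {0<..} E_max"
    by (auto simp: mono_on_def)
qed

lemma concave_m: "concave_on {0<..} m"
  unfolding concave_on_iff
proof (intro conjI ballI allI impI)
  fix x y u v :: real
  assume xy: "x \<in> {0<..}" "y \<in> {0<..}" and uv: "0 \<le> u" "0 \<le> v" "u + v = 1"
  have "u *\<^sub>R x + v *\<^sub>R y \<in> {0<..}"
    using convexD[OF convex_real_interval(3) xy uv] by simp
  then have pos: "0 < u * x + v * y"
    by simp
  then obtain \<rho> where \<rho>: "\<rho> \<in> M (u * x + v * y)"
    using M_nonempty by blast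
  then have X: "\<rho> \<in> X"
    using M_subset[OF pos] by blast
  have "u * m x + v * m y \<le> u * (S \<rho> - x / 2 * E \<rho>) + v * (S \<rho> - y / 2 * E \<rho>)"
    using xy uv X by (intro add_mono mult_left_mono m_le) auto
  also have "\<dots> = (u + v) * S \<rho> - (u * x + v * y) / 2 * E \<rho>"
    by (simp add: algebra_simps add_divide_distrib)
  also have "\<dots> = m (u * x + v * y)"
    using m_eq[OF pos \<rho>] uv by simp
  finally show "m (u *\<^sub>R x + v *\<^sub>R y) \<ge> u * m x + v * m y"
    by simp
qed (rule convex_real_interval)

lemma lipschitz_m: "(B / 2)-lipschitz_on {0<..} m"
proof (rule lipschitz_onI)
  fix x y :: real assume "x \<in> {0<..}" "y \<in> {0<..}"
  then have xy: "0 < x" "0 < y" by auto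
  obtain \<rho> \<rho>' where \<rho>: "\<rho> \<in> M x" "\<rho>' \<in> M y"
    using M_nonempty xy by blast
  then have "\<bar>E \<rho>\<bar> \<le> B" "\<bar>E \<rho>'\<bar> \<le> B"
    using xy M_subset E_bound by blast+
  moreover have "\<bar>- (y - x) / 2 * b\<bar> \<le> \<bar>y - x\<bar> / 2 * B" if "\<bar>b\<bar> \<le> B" for b
    using mult_left_mono[OF that, of "\<bar>y - x\<bar> / 2"] by (simp add: abs_mult abs_minus_commute)
  ultimately have "\<bar>- (y - x) / 2 * E \<rho>\<bar> \<le> \<bar>y - x\<bar> / 2 * B"
      "\<bar>- (y - x) / 2 * E \<rho>'\<bar> \<le> \<bar>y - x\<bar> / 2 * B"
    by blast+
  then have "\<bar>m y - m x\<bar> \<le> \<bar>y - x\<bar> / 2 * B"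
    using increment_bounds[OF xy \<rho>] by linarith
  then show "dist (m x) (m y) \<le> B / 2 * dist x y"
    by (simp add: dist_real_def abs_minus_commute mult.commute)
next
  obtain \<rho> where "\<rho> \<in> M 1"
    using M_nonempty[of 1] by auto
  then show "0 \<le> B / 2"
    using E_bound[of \<rho>] M_subset[of 1] abs_ge_zero[of "E \<rho>"] by auto
qed

text \<open>Upper hemicontinuity of \<open>M\<close> in terms of energies: otherwise a sequence of minimizers with
  parameters tending to \<open>\<kappa>\<close> would keep its energies away from those of \<open>M \<kappa>\<close>, although a
  subsequence converges to one of them.\<close>

lemma energies_upper_hemicontinuous:
  assumes "0 < \<kappa>" "0 < e"
  obtains d where "0 < d"
    "\<And>\<kappa>' \<rho>'. \<lbrakk>0 < \<kappa>'; \<rho>' \<in> M \<kappa>'; \<bar>\<kappa>' - \<kappa>\<bar> < d\<rbrakk> \<Longrightarrow> \<exists>\<rho>\<in>M \<kappa>. \<bar>E \<rho>' - E \<rho>\<bar> < e"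
proof (rule ccontr)
  note radius = that
  assume "\<not> thesis"
  have contra: "\<exists>\<kappa>' \<rho>'. 0 < \<kappa>' \<and> \<rho>' \<in> M \<kappa>' \<and> \<bar>\<kappa>' - \<kappa>\<bar> < d \<and> \<not> (\<exists>\<rho>\<in>M \<kappa>. \<bar>E \<rho>' - E \<rho>\<bar> < e)"
    if "0 < d" for d
    using radius[OF that] \<open>\<not> thesis\<close> by metis
  let ?far = "\<lambda>n p. 0 < fst p \<and> snd p \<in> M (fst p) \<and> \<bar>fst p - \<kappa>\<bar> < 1 / real (Suc n) \<and>
      (\<forall>\<rho>\<in>M \<kappa>. e \<le> \<bar>E (snd p) - E \<rho>\<bar>)"
  have "\<exists>p. ?far n p" for n
  proof -
    have "0 < 1 / real (Suc n)" by simp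
    then obtain \<kappa>' \<rho>' where "0 < \<kappa>'" "\<rho>' \<in> M \<kappa>'" "\<bar>\<kappa>' - \<kappa>\<bar> < 1 / real (Suc n)"
        "\<not> (\<exists>\<rho>\<in>M \<kappa>. \<bar>E \<rho>' - E \<rho>\<bar> < e)"
      using contra by metis
    then have "?far n (\<kappa>', \<rho>')"
      by (simp add: not_less)
    then show ?thesis ..
  qed
  then obtain p where p: "\<And>n. ?far n (p n)"
    by metis
  define \<kappa>s \<rho>s where "\<kappa>s n = fst (p n)" and "\<rho>s n = snd (p n)" for n
  have seq: "0 < \<kappa>s n" "\<rho>s n \<in> M (\<kappa>s n)" "\<bar>\<kappa>s n - \<kappa>\<bar> < 1 / real (Suc n)"
      "\<rho> \<in> M \<kappa> \<Longrightarrow> e \<le> \<bar>E (\<rho>s n) - E \<rho>\<bar>" for n \<rho>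
    using p[of n] by (auto simp: \<kappa>s_def \<rho>s_def)
  have "(\<lambda>n. \<kappa>s n - \<kappa>) \<longlonglongrightarrow> 0"
  proof (rule Lim_null_comparison)
    show "\<forall>\<^sub>F n in sequentially. norm (\<kappa>s n - \<kappa>) \<le> inverse (real (Suc n))"
      using seq(3) by (intro always_eventually allI) (simp add: divide_inverse less_imp_le)
  qed (rule LIMSEQ_inverse_real_of_nat)
  then have "\<kappa>s \<longlonglongrightarrow> \<kappa>"
    by (rule LIM_zero_cancel)
  from M_closed[OF seq(1) assms(1) this seq(2)] obtain r \<rho>0
    where "\<rho>0 \<in> M \<kappa>" "(\<lambda>j. E (\<rho>s (r j))) \<longlonglongrightarrow> E \<rho>0"
    by blast
  then have "\<forall>\<^sub>F j in sequentially. \<bar>E (\<rho>s (r j)) - E \<rho>0\<bar> < e"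
    using assms(2) by (auto dest: tendstoD simp: dist_real_def)
  then obtain j where "\<bar>E (\<rho>s (r j)) - E \<rho>0\<bar> < e"
    using eventually_happens'[OF sequentially_bot] by blast
  with seq(4)[OF \<open>\<rho>0 \<in> M \<kappa>\<close>] show False
    by (meson not_less)
qed

lemma right_derivative_m:
  assumes "0 < \<kappa>" shows "(m has_real_derivative - (1 / 2) * E_max \<kappa>) (at_right \<kappa>)"
  unfolding has_field_derivative_iff
proof (rule tendstoI)
  fix e :: real assume "0 < e"
  from energies_upper_hemicontinuous[OF assms this] obtain d where d: "0 < d"
      "\<And>\<kappa>' \<rho>'. \<lbrakk>0 < \<kappa>'; \<rho>' \<in> M \<kappa>'; \<bar>\<kappa>' - \<kappa>\<bar> < d\<rbrakk> \<Longrightarrow> \<exists>\<rho>\<in>M \<kappa>. \<bar>E \<rho>' - E \<rho>\<bar> < e"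
    by metis
  have "dist ((m \<kappa>' - m \<kappa>) / (\<kappa>' - \<kappa>)) (- (1 / 2) * E_max \<kappa>) < e" if \<kappa>': "\<kappa> < \<kappa>'" "\<kappa>' < \<kappa> + d" for \<kappa>'
  proof -
    have pos: "0 < \<kappa>'" using assms \<kappa>' by simp
    obtain \<rho>' where \<rho>': "\<rho>' \<in> M \<kappa>'"
      using M_nonempty[OF pos] by blast
    have "\<bar>\<kappa>' - \<kappa>\<bar> < d"
      using \<kappa>' by simp
    from d(2)[OF pos \<rho>' this] obtain \<rho> where \<rho>: "\<rho> \<in> M \<kappa>" "\<bar>E \<rho>' - E \<rho>\<bar> < e"
      by blast
    have "E_max \<kappa> \<le> - 2 * ((m \<kappa>' - m \<kappa>) / (\<kappa>' - \<kappa>))"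
      using slope_bounds(1)[OF assms \<kappa>'(1) _ \<rho>'] M_nonempty[OF assms] by (intro cSUP_least) auto
    moreover have "- 2 * ((m \<kappa>' - m \<kappa>) / (\<kappa>' - \<kappa>)) \<le> E \<rho>'"
      using slope_bounds(2)[OF assms \<kappa>'(1) \<rho>(1) \<rho>'] .
    ultimately show ?thesis
      using E_between(2)[OF assms \<rho>(1)] \<rho>(2) \<open>0 < e\<close> unfolding dist_real_def by linarith
  qed
  with d(1) show "\<forall>\<^sub>F \<kappa>' in at_right \<kappa>. dist ((m \<kappa>' - m \<kappa>) / (\<kappa>' - \<kappa>)) (- (1 / 2) * E_max \<kappa>) < e"
    unfolding eventually_at_right_field by (intro exI[of _ "\<kappa> + d"]) simp
qed

lemma left_derivative_m:
  assumes "0 < \<kappa>" shows "(m has_real_derivative - (1 / 2) * E_min \<kappa>) (at_left \<kappa>)"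
  unfolding has_field_derivative_iff
proof (rule tendstoI)
  fix e :: real assume "0 < e"
  from energies_upper_hemicontinuous[OF assms this] obtain d where d: "0 < d"
      "\<And>\<kappa>' \<rho>'. \<lbrakk>0 < \<kappa>'; \<rho>' \<in> M \<kappa>'; \<bar>\<kappa>' - \<kappa>\<bar> < d\<rbrakk> \<Longrightarrow> \<exists>\<rho>\<in>M \<kappa>. \<bar>E \<rho>' - E \<rho>\<bar> < e"
    by metis
  have "dist ((m \<kappa>' - m \<kappa>) / (\<kappa>' - \<kappa>)) (- (1 / 2) * E_min \<kappa>) < e" if \<kappa>': "0 < \<kappa>'" "\<kappa> - d < \<kappa>'" "\<kappa>' < \<kappa>" for \<kappa>'
  proof -
    obtain \<rho>' where \<rho>': "\<rho>' \<in> M \<kappa>'"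
      using M_nonempty[OF \<kappa>'(1)] by blast
    have "\<bar>\<kappa>' - \<kappa>\<bar> < d"
      using \<kappa>' by simp
    from d(2)[OF \<kappa>'(1) \<rho>' this] obtain \<rho> where \<rho>: "\<rho> \<in> M \<kappa>" "\<bar>E \<rho>' - E \<rho>\<bar> < e"
      by blast
    have swap: "(m \<kappa>' - m \<kappa>) / (\<kappa>' - \<kappa>) = (m \<kappa> - m \<kappa>') / (\<kappa> - \<kappa>')"
      using minus_divide_divide[of "m \<kappa> - m \<kappa>'" "\<kappa> - \<kappa>'"] by simp
    have "- 2 * ((m \<kappa>' - m \<kappa>) / (\<kappa>' - \<kappa>)) \<le> E_min \<kappa>"
      using slope_bounds(2)[OF \<kappa>'(1,3) \<rho>'] M_nonempty[OF assms] unfolding swap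
      by (intro cINF_greatest) auto
    moreover have "E \<rho>' \<le> - 2 * ((m \<kappa>' - m \<kappa>) / (\<kappa>' - \<kappa>))"
      using slope_bounds(1)[OF \<kappa>'(1,3) \<rho>' \<rho>(1)] unfolding swap .
    ultimately show ?thesis
      using E_between(1)[OF assms \<rho>(1)] \<rho>(2) \<open>0 < e\<close> unfolding dist_real_def by linarith
  qed
  then show "\<forall>\<^sub>F \<kappa>' in at_left \<kappa>. dist ((m \<kappa>' - m \<kappa>) / (\<kappa>' - \<kappa>)) (- (1 / 2) * E_min \<kappa>) < e"
    using d(1) assms unfolding eventually_at_left_field by (intro exI[of _ "max 0 (\<kappa> - d)"]) simp
qed

lemma differentiable_m_if_E_min_eq_E_max:
  assumes "0 < \<kappa>" "E_min \<kappa> = E_max \<kappa>" shows "m differentiable (at \<kappa>)"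
proof -
  have "(m has_real_derivative - (1 / 2) * E_max \<kappa>) (at \<kappa>)"
    using left_derivative_m[OF assms(1)] right_derivative_m[OF assms(1)] unfolding assms(2)
    by (auto simp: has_field_derivative_iff intro: filterlim_split_at)
  then show ?thesis
    unfolding real_differentiable_def ..
qed

lemma two_energies_if_not_differentiable:
  assumes "0 < \<kappa>" "\<not> m differentiable (at \<kappa>)" shows "\<exists>\<rho>1\<in>M \<kappa>. \<exists>\<rho>2\<in>M \<kappa>. E \<rho>1 \<noteq> E \<rho>2"
proof (rule ccontr)
  assume "\<not> ?thesis"
  moreover obtain \<rho> where "\<rho> \<in> M \<kappa>"
    using M_nonempty[OF assms(1)] by blast
  ultimately have "E ` M \<kappa> = {E \<rho>}"
    by blast
  then have "E_min \<kappa> = E_max \<kappa>"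
    by simp
  then show False
    using differentiable_m_if_E_min_eq_E_max[OF assms(1)] assms(2) by blast
qed

text \<open>The open intervals between \<open>E_min \<kappa>\<close> and \<open>E_max \<kappa>\<close> are pairwise disjoint, and each kink
  \<open>\<kappa>\<close> gives a nonempty one, which contains a rational number.\<close>

lemma countable_kinks: "countable {\<kappa> \<in> {0<..}. \<not> m differentiable (at \<kappa>)}" (is "countable ?N")
proof -
  have "E_min \<kappa> < E_max \<kappa>" if "\<kappa> \<in> ?N" for \<kappa>
  proof -
    have "0 < \<kappa>" "\<not> m differentiable (at \<kappa>)"
      using that by simp_all
    then have "E_min \<kappa> \<noteq> E_max \<kappa>"
      using differentiable_m_if_E_min_eq_E_max by metis
    with E_min_le_E_max[OF \<open>0 < \<kappa>\<close>] show ?thesis by linarith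
  qed
  then have "\<exists>q\<in>\<rat>. E_min \<kappa> < q \<and> q < E_max \<kappa>" if "\<kappa> \<in> ?N" for \<kappa>
    using Rats_dense_in_real[of "E_min \<kappa>" "E_max \<kappa>"] that by simp
  then have "\<forall>\<kappa>\<in>?N. \<exists>q. q \<in> \<rat> \<and> E_min \<kappa> < q \<and> q < E_max \<kappa>"
    by blast
  from bchoice[OF this] obtain q
    where q: "\<And>\<kappa>. \<kappa> \<in> ?N \<Longrightarrow> q \<kappa> \<in> \<rat> \<and> E_min \<kappa> < q \<kappa> \<and> q \<kappa> < E_max \<kappa>"
    by blast
  have q_less: "q \<kappa> < q \<kappa>'" if "\<kappa> \<in> ?N" "\<kappa>' \<in> ?N" "\<kappa> < \<kappa>'" for \<kappa> \<kappa>'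
  proof -
    have "E_max \<kappa> \<le> E_min \<kappa>'"
      using E_max_le_E_min[OF _ that(3)] that(1) by simp
    then show ?thesis
      using q[OF that(1)] q[OF that(2)] by linarith
  qed
  have "inj_on q ?N"
  proof (rule inj_onI)
    fix x y assume "x \<in> ?N" "y \<in> ?N" "q x = q y"
    then show "x = y"
      using q_less[of x y] q_less[of y x] by (cases x y rule: linorder_cases) simp_all
  qed
  moreover have "q ` ?N \<subseteq> \<rat>"
    using q by blast
  then have "countable (q ` ?N)"
    using countable_rat by (rule countable_subset)
  ultimately show ?thesis
    by (rule countable_image_inj_on[rotated])
qed

end

section \<open>Densities and entropy on the circle\<close>

lemma sets_circle [simp, measurable_cong]: "sets circle = sets borel"
  by (simp add: circle_def)

lemma space_circle [simp]: "space circle = UNIV"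
  by (simp add: circle_def)

lemma borel_measurable_circle [simp]: "borel_measurable circle = borel_measurable borel"
  by (rule measurable_cong_sets) simp_all

lemma AE_circle: "AE \<theta> in circle. \<theta> \<in> {0..<2 * pi}"
  unfolding circle_def by (rule AE_uniform_measureI) auto

interpretation circle: prob_space circle
  unfolding circle_def by (rule prob_space_uniform_measure) auto

interpretation circle_pair: pair_sigma_finite circle circle ..

lemma integrable_bounded_times:
  fixes f g :: "real \<Rightarrow> real"
  assumes "integrable circle f" "g \<in> borel_measurable borel" "\<And>\<theta>. \<bar>g \<theta>\<bar> \<le> C"
  shows "integrable circle (\<lambda>\<theta>. g \<theta> * f \<theta>)"
proof (rule Bochner_Integration.integrable_bound)
  show "integrable circle (\<lambda>\<theta>. C * f \<theta>)"
    using assms by simp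
  show "(\<lambda>\<theta>. g \<theta> * f \<theta>) \<in> borel_measurable circle"
    using assms borel_measurable_integrable[OF assms(1)] by simp
  have "\<bar>g \<theta>\<bar> * \<bar>f \<theta>\<bar> \<le> \<bar>C\<bar> * \<bar>f \<theta>\<bar>" for \<theta>
    using assms(3)[of \<theta>] by (intro mult_right_mono) auto
  then show "AE \<theta> in circle. norm (g \<theta> * f \<theta>) \<le> norm (C * f \<theta>)"
    by (simp add: abs_mult)
qed

lemma integrable_bounded:
  fixes g :: "real \<Rightarrow> real"
  assumes "g \<in> borel_measurable borel" "\<And>\<theta>. \<bar>g \<theta>\<bar> \<le> C"
  shows "integrable circle g"
  using integrable_bounded_times[of "\<lambda>_. 1" g C] assms by simp

lemma abs_integral_bounded_times_le:
  fixes f g :: "real \<Rightarrow> real"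
  assumes "integrable circle f" "g \<in> borel_measurable borel" "\<And>\<theta>. \<bar>g \<theta>\<bar> \<le> C"
  shows "\<bar>LINT \<theta>|circle. g \<theta> * f \<theta>\<bar> \<le> C * (LINT \<theta>|circle. \<bar>f \<theta>\<bar>)"
proof -
  have "\<bar>LINT \<theta>|circle. g \<theta> * f \<theta>\<bar> \<le> (LINT \<theta>|circle. \<bar>g \<theta> * f \<theta>\<bar>)"
    by (rule integral_abs_bound)
  also have "\<dots> \<le> (LINT \<theta>|circle. C * \<bar>f \<theta>\<bar>)"
  proof (rule integral_mono)
    show "integrable circle (\<lambda>\<theta>. \<bar>g \<theta> * f \<theta>\<bar>)"
      using integrable_bounded_times[OF assms] by (rule integrable_abs)
  qed (use assms in \<open>auto simp: abs_mult intro: mult_right_mono\<close>)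
  finally show ?thesis
    by simp
qed

definition prob_density :: "(real \<Rightarrow> real) \<Rightarrow> bool"
  where "prob_density f \<longleftrightarrow>
    integrable circle f \<and> (AE \<theta> in circle. 0 < f \<theta>) \<and> (LINT \<theta>|circle. f \<theta>) = 1"

definition finite_entropy :: "(real \<Rightarrow> real) \<Rightarrow> bool"
  where "finite_entropy f \<longleftrightarrow> integrable circle (\<lambda>\<theta>. f \<theta> * ln (f \<theta>))"

definition neg_entropy :: "(real \<Rightarrow> real) \<Rightarrow> real"
  where "neg_entropy f = (LINT \<theta>|circle. f \<theta> * ln (f \<theta>))"

lemma prob_density_measurable: "prob_density f \<Longrightarrow> f \<in> borel_measurable borel"
  unfolding prob_density_def using borel_measurable_integrable by fastforce

lemma prob_density_abs_integral:
  assumes "prob_density f" shows "(LINT \<theta>|circle. \<bar>f \<theta>\<bar>) = 1"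
proof -
  have "(LINT \<theta>|circle. \<bar>f \<theta>\<bar>) = (LINT \<theta>|circle. f \<theta>)"
    using assms prob_density_measurable[OF assms] unfolding prob_density_def
    by (intro integral_cong_AE) (auto elim: eventually_mono)
  then show ?thesis
    using assms by (simp add: prob_density_def)
qed

lemma prob_density_mix:
  assumes "prob_density f" "prob_density g" "0 \<le> t" "t \<le> 1"
  shows "prob_density (\<lambda>\<theta>. (1 - t) * f \<theta> + t * g \<theta>)"
proof -
  have "AE \<theta> in circle. 0 < f \<theta>" "AE \<theta> in circle. 0 < g \<theta>"
    using assms by (simp_all add: prob_density_def)
  then have "AE \<theta> in circle. 0 < (1 - t) * f \<theta> + t * g \<theta>"
  proof eventually_elim
    case (elim \<theta>)
    then show ?case
      using convexD[OF convex_real_interval(3)[of 0], of "f \<theta>" "g \<theta>" "1 - t" t] assms by simp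
  qed
  then show ?thesis
    using assms by (simp add: prob_density_def)
qed

text \<open>The inequality \<open>ln s \<le> s - 1\<close> at \<open>s = y / x\<close>, equivalently the tangent inequality for the
  convex function \<open>x ln x\<close>. It underlies all entropy estimates.\<close>

lemma diff_le_x_ln_quotient:
  fixes x y :: real assumes "0 < x" "0 < y" shows "x - y \<le> x * ln x - x * ln y"
proof -
  have "ln (y / x) \<le> y / x - 1"
    using assms by (intro ln_le_minus_one) simp
  then have "x * ln (y / x) \<le> x * (y / x - 1)"
    using assms by (intro mult_left_mono) auto
  then show ?thesis
    using assms by (simp add: ln_div right_diff_distrib)
qed

lemma x_ln_x_convex:
  fixes x y :: real assumes "0 < x" "0 < y" "0 \<le> t" "t \<le> 1"
  defines "z \<equiv> (1 - t) * x + t * y"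
  shows "z * ln z \<le> (1 - t) * (x * ln x) + t * (y * ln y)"
proof -
  have "0 < z"
    using convexD[OF convex_real_interval(3)[of 0], of x y "1 - t" t] assms by simp
  then have "(1 - t) * (x - z) + t * (y - z) \<le> (1 - t) * (x * ln x - x * ln z) + t * (y * ln y - y * ln z)"
    using assms by (intro add_mono mult_left_mono diff_le_x_ln_quotient) auto
  moreover have "(1 - t) * (x - z) + t * (y - z) = 0"
    by (simp add: z_def algebra_simps)
  moreover have "(1 - t) * (x * ln x - x * ln z) + t * (y * ln y - y * ln z)
      = (1 - t) * (x * ln x) + t * (y * ln y) - z * ln z"
    by (simp add: z_def algebra_simps)
  ultimately show ?thesis
    by linarith
qed

text \<open>Besides convexity, the bounds \<open>h - 1 \<le> h ln h \<le> (1 - t) f ln f + t g ln g\<close> keep the entropy of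
  a mixture finite.\<close>

lemma neg_entropy_mix:
  assumes "prob_density f" "prob_density g" "finite_entropy f" "finite_entropy g" "0 \<le> t" "t \<le> 1"
  defines "h \<equiv> \<lambda>\<theta>. (1 - t) * f \<theta> + t * g \<theta>"
  shows "finite_entropy h" "neg_entropy h \<le> (1 - t) * neg_entropy f + t * neg_entropy g"
proof -
  define u where "u \<theta> = (1 - t) * (f \<theta> * ln (f \<theta>)) + t * (g \<theta> * ln (g \<theta>))" for \<theta>
  have u: "integrable circle u"
    using assms by (simp add: u_def[abs_def] finite_entropy_def)
  have h: "prob_density h"
    unfolding h_def using assms by (intro prob_density_mix)
  have pos: "AE \<theta> in circle. 0 < f \<theta>" "AE \<theta> in circle. 0 < g \<theta>" "AE \<theta> in circle. 0 < h \<theta>"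
    using assms(1,2) h by (simp_all add: prob_density_def)
  from pos have between: "AE \<theta> in circle. h \<theta> - 1 \<le> h \<theta> * ln (h \<theta>) \<and> h \<theta> * ln (h \<theta>) \<le> u \<theta>"
  proof eventually_elim
    case (elim \<theta>)
    then show ?case
      using x_ln_x_convex[of "f \<theta>" "g \<theta>" t] diff_le_x_ln_quotient[of "h \<theta>" 1] assms(5,6)
      by (simp add: h_def u_def)
  qed
  have meas: "(\<lambda>\<theta>. h \<theta> * ln (h \<theta>)) \<in> borel_measurable borel"
    using prob_density_measurable[OF h] by measurable
  show fin: "finite_entropy h"
    unfolding finite_entropy_def
  proof (rule Bochner_Integration.integrable_bound)
    show "integrable circle (\<lambda>\<theta>. \<bar>h \<theta> - 1\<bar> + \<bar>u \<theta>\<bar>)"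
      using h u by (simp add: prob_density_def)
    show "AE \<theta> in circle. norm (h \<theta> * ln (h \<theta>)) \<le> norm (\<bar>h \<theta> - 1\<bar> + \<bar>u \<theta>\<bar>)"
      using between by eventually_elim (unfold real_norm_def, linarith)
  qed (use meas in simp)
  have "neg_entropy h \<le> integral\<^sup>L circle u"
    unfolding neg_entropy_def using fin u between
    by (intro integral_mono_AE) (auto simp: finite_entropy_def elim: eventually_mono)
  also have "\<dots> = (1 - t) * neg_entropy f + t * neg_entropy g"
    using assms by (simp add: u_def[abs_def] finite_entropy_def neg_entropy_def)
  finally show "neg_entropy h \<le> (1 - t) * neg_entropy f + t * neg_entropy g" .
qed

lemma neg_entropy_nonneg:
  assumes "prob_density f" "finite_entropy f" shows "0 \<le> neg_entropy f"
proof -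
  have "(LINT \<theta>|circle. f \<theta> - 1) \<le> neg_entropy f"
    unfolding neg_entropy_def
  proof (rule integral_mono_AE)
    have "AE \<theta> in circle. 0 < f \<theta>"
      using assms by (simp add: prob_density_def)
    then show "AE \<theta> in circle. f \<theta> - 1 \<le> f \<theta> * ln (f \<theta>)"
      by eventually_elim (use diff_le_x_ln_quotient[of _ 1] in force)
  qed (use assms in \<open>auto simp: prob_density_def finite_entropy_def\<close>)
  then show ?thesis
    using assms by (simp add: prob_density_def circle.prob_space[simplified])
qed

text \<open>The same inequality at \<open>s = \<surd>y / \<surd>x\<close>, where it is sharper.\<close>

lemma hellinger_le_relative_entropy:
  fixes x y :: real assumes "0 < x" "0 < y"
  shows "(sqrt x - sqrt y)\<^sup>2 \<le> x * ln x - x * ln y - x + y"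
proof -
  have "x * (2 * ln (sqrt y / sqrt x)) \<le> x * (2 * (sqrt y / sqrt x - 1))"
    using assms by (intro mult_left_mono ln_le_minus_one) auto
  moreover have "x * (2 * ln (sqrt y / sqrt x)) = x * ln y - x * ln x"
    using assms by (simp add: ln_div ln_sqrt algebra_simps)
  moreover have "x * (2 * (sqrt y / sqrt x - 1)) = 2 * sqrt x * sqrt y - 2 * x"
  proof -
    have "x / sqrt x = sqrt x"
      using assms by (simp add: real_div_sqrt)
    then have "x * (sqrt y / sqrt x) = sqrt x * sqrt y"
      by (metis times_divide_eq_left times_divide_eq_right mult.commute)
    moreover have "x * (2 * (q - 1)) = 2 * (x * q) - 2 * x" for q
      by (simp add: algebra_simps)
    ultimately show ?thesis
      by (simp only: mult.assoc)
  qed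
  ultimately show ?thesis
    using assms by (simp add: power2_diff)
qed

text \<open>Factor \<open>\<bar>x - y\<bar> = \<bar>\<surd>x - \<surd>y\<bar> (\<surd>x + \<surd>y)\<close> and apply the inequality between arithmetic
  and geometric means with weight \<open>e\<close>.\<close>

lemma abs_diff_le_relative_entropy:
  fixes x y :: real assumes "0 < x" "0 < y" "0 < e"
  shows "\<bar>x - y\<bar> \<le> (x * ln x - x * ln y - x + y) / (2 * e) + e * (x + y)"
proof -
  define a b where "a = sqrt x" and "b = sqrt y"
  have ab: "0 \<le> a" "0 \<le> b" and xy: "x = a\<^sup>2" "y = b\<^sup>2"
    using assms by (auto simp: a_def b_def)
  have "\<bar>x - y\<bar> = \<bar>a - b\<bar> * (a + b)"
    using ab by (simp add: xy power2_eq_square square_diff_square_factored abs_mult mult.commute)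
  also have "\<dots> \<le> (a - b)\<^sup>2 / (2 * e) + e / 2 * (a + b)\<^sup>2"
  proof -
    have "0 \<le> (\<bar>a - b\<bar> - e * (a + b))\<^sup>2"
      by simp
    then have "\<bar>a - b\<bar> * (a + b) * (2 * e) \<le> (a - b)\<^sup>2 + e\<^sup>2 * (a + b)\<^sup>2"
      unfolding power2_diff power_mult_distrib power2_abs by (simp only: mult_ac)
    then have "\<bar>a - b\<bar> * (a + b) \<le> ((a - b)\<^sup>2 + e\<^sup>2 * (a + b)\<^sup>2) / (2 * e)"
      using assms by (subst pos_le_divide_eq) auto
    also have "\<dots> = (a - b)\<^sup>2 / (2 * e) + e / 2 * (a + b)\<^sup>2"
      using assms by (simp add: add_divide_distrib power2_eq_square)
    finally show ?thesis .
  qed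
  also have "\<dots> \<le> (x * ln x - x * ln y - x + y) / (2 * e) + e * (x + y)"
  proof (intro add_mono divide_right_mono)
    show "(a - b)\<^sup>2 \<le> x * ln x - x * ln y - x + y"
      unfolding a_def b_def using assms by (intro hellinger_le_relative_entropy)
    have "0 \<le> (a - b)\<^sup>2"
      by simp
    then have "(a + b)\<^sup>2 \<le> 2 * (x + y)"
      by (simp add: xy power2_sum power2_diff)
    then show "e / 2 * (a + b)\<^sup>2 \<le> e * (x + y)"
      using mult_left_mono[of "(a + b)\<^sup>2" "2 * (x + y)" "e / 2"] assms by simp
  qed (use assms in simp)
  finally show ?thesis .
qed

section \<open>Gibbs densities and relative entropy\<close>

definition potential :: "(real \<Rightarrow> real) \<Rightarrow> (real \<Rightarrow> real) \<Rightarrow> real \<Rightarrow> real"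
  where "potential W f \<theta> = (LINT \<phi>|circle. W (\<theta> - \<phi>) * f \<phi>)"

definition energy :: "(real \<Rightarrow> real) \<Rightarrow> (real \<Rightarrow> real) \<Rightarrow> real"
  where "energy W f = (LINT \<theta>|circle. potential W f \<theta> * f \<theta>)"

definition partition_function :: "real \<Rightarrow> (real \<Rightarrow> real) \<Rightarrow> real"
  where "partition_function \<kappa> V = (LINT \<theta>|circle. exp (\<kappa> * V \<theta>))"

definition gibbs :: "real \<Rightarrow> (real \<Rightarrow> real) \<Rightarrow> real \<Rightarrow> real"
  where "gibbs \<kappa> V \<theta> = exp (\<kappa> * V \<theta>) / partition_function \<kappa> V"

text \<open>The relative entropy of \<open>f\<close> with respect to \<open>gibbs \<kappa> V\<close>, with \<open>ln (gibbs \<kappa> V)\<close> expanded: up to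
  the constant, it is the free energy of independent particles in the external potential \<open>V\<close>.\<close>

definition relative_entropy :: "real \<Rightarrow> (real \<Rightarrow> real) \<Rightarrow> (real \<Rightarrow> real) \<Rightarrow> real"
  where "relative_entropy \<kappa> V f =
    neg_entropy f - \<kappa> * (LINT \<theta>|circle. V \<theta> * f \<theta>) + ln (partition_function \<kappa> V)"

context
  fixes \<kappa> C :: real and V :: "real \<Rightarrow> real"
  assumes V_meas [measurable]: "V \<in> borel_measurable borel"
    and V_bound: "\<And>\<theta>. \<bar>V \<theta>\<bar> \<le> C"
begin

lemma exp_potential_bounds: "exp (- (\<bar>\<kappa>\<bar> * C)) \<le> exp (\<kappa> * V \<theta>)" "exp (\<kappa> * V \<theta>) \<le> exp (\<bar>\<kappa>\<bar> * C)"
proof -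
  have "\<bar>\<kappa> * V \<theta>\<bar> \<le> \<bar>\<kappa>\<bar> * C"
    using V_bound[of \<theta>] by (simp add: abs_mult mult_left_mono)
  then show "exp (- (\<bar>\<kappa>\<bar> * C)) \<le> exp (\<kappa> * V \<theta>)" "exp (\<kappa> * V \<theta>) \<le> exp (\<bar>\<kappa>\<bar> * C)"
    by auto
qed

lemma integrable_exp_potential: "integrable circle (\<lambda>\<theta>. exp (\<kappa> * V \<theta>))"
  by (rule integrable_bounded[of _ "exp (\<bar>\<kappa>\<bar> * C)"]) (use exp_potential_bounds in auto)

lemma partition_function_ge: "exp (- (\<bar>\<kappa>\<bar> * C)) \<le> partition_function \<kappa> V"
proof -
  have "(LINT \<theta>|circle. exp (- (\<bar>\<kappa>\<bar> * C))) \<le> partition_function \<kappa> V"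
    unfolding partition_function_def
    by (intro integral_mono integrable_exp_potential exp_potential_bounds) simp
  then show ?thesis
    by (simp add: circle.prob_space[simplified])
qed

lemma partition_function_pos: "0 < partition_function \<kappa> V"
  using partition_function_ge exp_gt_zero by (rule order.strict_trans2[rotated])

lemma gibbs_measurable [measurable]: "gibbs \<kappa> V \<in> borel_measurable borel"
  unfolding gibbs_def[abs_def] by measurable

lemma gibbs_pos: "0 < gibbs \<kappa> V \<theta>"
  by (simp add: gibbs_def partition_function_pos)

lemma gibbs_le: "gibbs \<kappa> V \<theta> \<le> exp (2 * (\<bar>\<kappa>\<bar> * C))"
proof -
  have "gibbs \<kappa> V \<theta> \<le> exp (\<bar>\<kappa>\<bar> * C) / exp (- (\<bar>\<kappa>\<bar> * C))"
    unfolding gibbs_def by (intro frac_le exp_potential_bounds partition_function_ge) auto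
  also have "\<dots> = exp (2 * (\<bar>\<kappa>\<bar> * C))"
    by (simp add: exp_diff[symmetric])
  finally show ?thesis .
qed

lemma prob_density_gibbs: "prob_density (gibbs \<kappa> V)"
proof -
  have "(LINT \<theta>|circle. gibbs \<kappa> V \<theta>) = partition_function \<kappa> V / partition_function \<kappa> V"
    unfolding gibbs_def[abs_def] by (simp add: partition_function_def)
  moreover have "integrable circle (gibbs \<kappa> V)"
    unfolding gibbs_def[abs_def] using integrable_exp_potential by simp
  ultimately show ?thesis
    unfolding prob_density_def using gibbs_pos partition_function_pos by simp
qed

lemma ln_gibbs: "ln (gibbs \<kappa> V \<theta>) = \<kappa> * V \<theta> - ln (partition_function \<kappa> V)"
  using partition_function_pos by (simp add: gibbs_def ln_div)

lemma integrable_potential_times: "integrable circle f \<Longrightarrow> integrable circle (\<lambda>\<theta>. V \<theta> * f \<theta>)"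
  by (rule integrable_bounded_times[OF _ V_meas V_bound])

lemma finite_entropy_gibbs: "finite_entropy (gibbs \<kappa> V)"
proof -
  have "integrable circle (\<lambda>\<theta>. \<kappa> * (V \<theta> * gibbs \<kappa> V \<theta>) - ln (partition_function \<kappa> V) * gibbs \<kappa> V \<theta>)"
    using prob_density_gibbs integrable_potential_times by (simp add: prob_density_def)
  then show ?thesis
    by (simp add: finite_entropy_def ln_gibbs algebra_simps)
qed

lemma relative_entropy_gibbs: "relative_entropy \<kappa> V (gibbs \<kappa> V) = 0"
proof -
  have "neg_entropy (gibbs \<kappa> V)
      = (LINT \<theta>|circle. \<kappa> * (V \<theta> * gibbs \<kappa> V \<theta>) - ln (partition_function \<kappa> V) * gibbs \<kappa> V \<theta>)"
    by (simp add: neg_entropy_def ln_gibbs algebra_simps)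
  also have "\<dots> = \<kappa> * (LINT \<theta>|circle. V \<theta> * gibbs \<kappa> V \<theta>) - ln (partition_function \<kappa> V)"
    using prob_density_gibbs integrable_potential_times by (simp add: prob_density_def)
  finally show ?thesis
    by (simp add: relative_entropy_def)
qed

lemma relative_entropy_eq_integral:
  assumes "prob_density f" "finite_entropy f"
  defines "k \<equiv> \<lambda>\<theta>. f \<theta> * ln (f \<theta>) - f \<theta> * ln (gibbs \<kappa> V \<theta>) - f \<theta> + gibbs \<kappa> V \<theta>"
  shows "integrable circle k" "integral\<^sup>L circle k = relative_entropy \<kappa> V f"
proof -
  have k: "k = (\<lambda>\<theta>. f \<theta> * ln (f \<theta>) - \<kappa> * (V \<theta> * f \<theta>) + ln (partition_function \<kappa> V) * f \<theta>
      - f \<theta> + gibbs \<kappa> V \<theta>)"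
    by (simp add: k_def ln_gibbs fun_eq_iff algebra_simps)
  have int: "integrable circle f" "integrable circle (gibbs \<kappa> V)" "integrable circle (\<lambda>\<theta>. V \<theta> * f \<theta>)"
      "integrable circle (\<lambda>\<theta>. f \<theta> * ln (f \<theta>))"
    using assms prob_density_gibbs integrable_potential_times
    by (simp_all add: prob_density_def finite_entropy_def)
  then show "integrable circle k"
    by (simp add: k)
  show "integral\<^sup>L circle k = relative_entropy \<kappa> V f"
    using int assms(1) prob_density_gibbs
    by (simp add: k relative_entropy_def neg_entropy_def prob_density_def)
qed

lemma relative_entropy_nonneg:
  assumes "prob_density f" "finite_entropy f"
  shows "0 \<le> relative_entropy \<kappa> V f"
  unfolding relative_entropy_eq_integral(2)[OF assms, symmetric]
proof (rule integral_nonneg_AE)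
  have "AE \<theta> in circle. 0 < f \<theta>"
    using assms by (simp add: prob_density_def)
  then show "AE \<theta> in circle. 0 \<le> f \<theta> * ln (f \<theta>) - f \<theta> * ln (gibbs \<kappa> V \<theta>) - f \<theta> + gibbs \<kappa> V \<theta>"
  proof eventually_elim
    case (elim \<theta>)
    then show ?case
      using diff_le_x_ln_quotient[OF elim gibbs_pos[of \<theta>]] by simp
  qed
qed

text \<open>A form of Pinsker's inequality: optimising over \<open>e\<close> gives the bound \<open>2 \<surd>R\<close> by the relative
  entropy \<open>R\<close>. Keeping \<open>e\<close> free makes it the integral of a pointwise inequality.\<close>

lemma L1_dist_gibbs_le:
  assumes "prob_density f" "finite_entropy f" "0 < e"
  shows "(LINT \<theta>|circle. \<bar>f \<theta> - gibbs \<kappa> V \<theta>\<bar>) \<le> relative_entropy \<kappa> V f / (2 * e) + 2 * e"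
proof -
  define k where "k = (\<lambda>\<theta>. f \<theta> * ln (f \<theta>) - f \<theta> * ln (gibbs \<kappa> V \<theta>) - f \<theta> + gibbs \<kappa> V \<theta>)"
  note k = relative_entropy_eq_integral[OF assms(1,2), folded k_def]
  have int: "integrable circle f" "integrable circle (gibbs \<kappa> V)" "AE \<theta> in circle. 0 < f \<theta>"
    using assms prob_density_gibbs by (simp_all add: prob_density_def)
  have "(LINT \<theta>|circle. \<bar>f \<theta> - gibbs \<kappa> V \<theta>\<bar>) \<le> (LINT \<theta>|circle. k \<theta> / (2 * e) + e * (f \<theta> + gibbs \<kappa> V \<theta>))"
  proof (rule integral_mono_AE)
    show "AE \<theta> in circle. \<bar>f \<theta> - gibbs \<kappa> V \<theta>\<bar> \<le> k \<theta> / (2 * e) + e * (f \<theta> + gibbs \<kappa> V \<theta>)"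
      using int(3)
    proof eventually_elim
      case (elim \<theta>)
      show ?case
        unfolding k_def by (rule abs_diff_le_relative_entropy[OF elim gibbs_pos assms(3)])
    qed
  qed (use int k(1) in simp_all)
  also have "\<dots> = integral\<^sup>L circle k / (2 * e) + e * ((LINT \<theta>|circle. f \<theta>) + (LINT \<theta>|circle. gibbs \<kappa> V \<theta>))"
    using int k(1) by simp
  also have "\<dots> = relative_entropy \<kappa> V f / (2 * e) + 2 * e"
    using assms(1) prob_density_gibbs by (simp add: k(2) prob_density_def)
  finally show ?thesis .
qed

end

section \<open>The interaction energy of a bounded continuous kernel\<close>

locale interaction_kernel =
  fixes W :: "real \<Rightarrow> real" and B :: real
  assumes W_even: "W (- \<theta>) = W \<theta>"
    and W_continuous: "continuous_on UNIV W"
    and W_bound: "\<bar>W \<theta>\<bar> \<le> B"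
begin

lemma B_nonneg: "0 \<le> B"
  using W_bound[of 0] by simp

lemma W_measurable [measurable]: "W \<in> borel_measurable borel"
  using W_continuous by (rule borel_measurable_continuous_onI)

lemma integrable_kernel: "integrable circle f \<Longrightarrow> integrable circle (\<lambda>\<phi>. W (\<theta> - \<phi>) * f \<phi>)"
  by (rule integrable_bounded_times[OF _ _ W_bound]) auto

lemma potential_measurable [measurable]:
  assumes "integrable circle f" shows "potential W f \<in> borel_measurable borel"
proof -
  have [measurable]: "f \<in> borel_measurable borel"
    using borel_measurable_integrable[OF assms] by simp
  have "(\<lambda>(\<theta>, \<phi>). W (\<theta> - \<phi>) * f \<phi>) \<in> borel_measurable (circle \<Otimes>\<^sub>M circle)"
    by measurable
  from circle.borel_measurable_lebesgue_integral[OF this] show ?thesis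
    by (simp add: potential_def[abs_def])
qed

lemma potential_bound:
  assumes "integrable circle f" shows "\<bar>potential W f \<theta>\<bar> \<le> B * (LINT \<phi>|circle. \<bar>f \<phi>\<bar>)"
  unfolding potential_def using assms by (rule abs_integral_bounded_times_le) (auto simp: W_bound)

lemma potential_bound_density: "prob_density f \<Longrightarrow> \<bar>potential W f \<theta>\<bar> \<le> B"
  using potential_bound[of f \<theta>] by (simp add: prob_density_abs_integral prob_density_def)

lemma potential_mix:
  assumes "integrable circle f" "integrable circle g"
  shows "potential W (\<lambda>\<theta>. a * f \<theta> + b * g \<theta>) \<theta> = a * potential W f \<theta> + b * potential W g \<theta>"
proof -
  have "potential W (\<lambda>\<theta>. a * f \<theta> + b * g \<theta>) \<theta>
      = (LINT \<phi>|circle. a * (W (\<theta> - \<phi>) * f \<phi>) + b * (W (\<theta> - \<phi>) * g \<phi>))"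
    unfolding potential_def by (intro Bochner_Integration.integral_cong) (auto simp: algebra_simps)
  then show ?thesis
    using assms integrable_kernel by (simp add: potential_def)
qed

lemma potential_dist:
  assumes "integrable circle f" "integrable circle g"
  shows "\<bar>potential W f \<theta> - potential W g \<theta>\<bar> \<le> B * (LINT \<phi>|circle. \<bar>f \<phi> - g \<phi>\<bar>)"
  using potential_mix[OF assms, of 1 "- 1"] potential_bound[of "\<lambda>\<phi>. f \<phi> - g \<phi>" \<theta>] assms by simp

lemma integrable_potential:
  assumes "integrable circle f" "integrable circle g"
  shows "integrable circle (\<lambda>\<theta>. potential W f \<theta> * g \<theta>)"
  using assms by (intro integrable_bounded_times[OF _ _ potential_bound]) auto

text \<open>Fubini and evenness of \<open>W\<close>: the interaction is a symmetric bilinear form, which is why the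
  potential \<open>potential W f\<close> is the derivative of half the interaction energy at \<open>f\<close>.\<close>

lemma potential_symmetric:
  assumes f: "integrable circle f" and g: "integrable circle g"
  shows "(LINT \<theta>|circle. potential W f \<theta> * g \<theta>) = (LINT \<theta>|circle. potential W g \<theta> * f \<theta>)"
proof -
  let ?k = "\<lambda>\<theta> \<phi>. W (\<theta> - \<phi>) * f \<phi> * g \<theta>"
  have [measurable]: "f \<in> borel_measurable borel" "g \<in> borel_measurable borel"
    using borel_measurable_integrable[OF f] borel_measurable_integrable[OF g] by simp_all
  have abs_int: "integrable circle (\<lambda>x. LINT y|circle. norm (?k x y))"
  proof (rule Bochner_Integration.integrable_bound)
    show "integrable circle (\<lambda>x. B * (LINT y|circle. \<bar>f y\<bar>) * \<bar>g x\<bar>)"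
      using g by simp
    have "(\<lambda>(x, y). norm (?k x y)) \<in> borel_measurable (circle \<Otimes>\<^sub>M circle)"
      by measurable
    from circle.borel_measurable_lebesgue_integral[OF this]
    show "(\<lambda>x. LINT y|circle. norm (?k x y)) \<in> borel_measurable circle"
      by simp
    have "\<bar>LINT y|circle. \<bar>?k x y\<bar>\<bar> \<le> B * (LINT y|circle. \<bar>f y\<bar>) * \<bar>g x\<bar>" for x
      using abs_integral_bounded_times_le[of "\<lambda>y. \<bar>f y\<bar>" "\<lambda>y. \<bar>W (x - y)\<bar>" B] f W_bound
      by (simp add: abs_mult mult_right_mono)
    then show "AE x in circle. norm (LINT y|circle. norm (?k x y))
        \<le> norm (B * (LINT y|circle. \<bar>f y\<bar>) * \<bar>g x\<bar>)"
      using B_nonneg by (auto simp: abs_mult intro!: AE_I2)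
  qed
  have int: "integrable (circle \<Otimes>\<^sub>M circle) (\<lambda>(\<theta>, \<phi>). ?k \<theta> \<phi>)"
  proof (rule circle_pair.Fubini_integrable)
    show "AE x in circle. integrable circle (\<lambda>y. case (x, y) of (\<theta>, \<phi>) \<Rightarrow> ?k \<theta> \<phi>)"
      using integrable_kernel[OF f] by simp
  qed (use abs_int in \<open>simp_all\<close>)
  have "(LINT \<theta>|circle. potential W f \<theta> * g \<theta>) = (LINT \<theta>|circle. LINT \<phi>|circle. ?k \<theta> \<phi>)"
    by (simp add: potential_def)
  also have "\<dots> = (LINT \<phi>|circle. LINT \<theta>|circle. ?k \<theta> \<phi>)"
    by (rule circle_pair.Fubini_integral[OF int, symmetric])
  also have "\<dots> = (LINT \<phi>|circle. LINT \<theta>|circle. W (\<phi> - \<theta>) * g \<theta> * f \<phi>)"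
    using W_even[of "_ - _"] by (simp add: mult_ac)
  also have "\<dots> = (LINT \<theta>|circle. potential W g \<theta> * f \<theta>)"
    by (simp add: potential_def)
  finally show ?thesis .
qed

lemma energy_bound:
  assumes "prob_density f" shows "\<bar>energy W f\<bar> \<le> B"
  unfolding energy_def
  using abs_integral_bounded_times_le[of f "potential W f" B] assms potential_bound_density[OF assms]
  by (simp add: prob_density_abs_integral prob_density_def)

lemma energy_dist:
  assumes "prob_density f" "prob_density g"
  shows "\<bar>energy W f - energy W g\<bar> \<le> 2 * B * (LINT \<theta>|circle. \<bar>f \<theta> - g \<theta>\<bar>)"
proof -
  let ?d = "LINT \<theta>|circle. \<bar>f \<theta> - g \<theta>\<bar>"
  have int: "integrable circle f" "integrable circle g"
    using assms by (simp_all add: prob_density_def)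
  note int' = integrable_potential[OF int(1) int(1)] integrable_potential[OF int(1) int(2)]
    integrable_potential[OF int(2) int(2)]
  have "(LINT \<theta>|circle. potential W f \<theta> * (f \<theta> - g \<theta>)) + (LINT \<theta>|circle. (potential W f \<theta> - potential W g \<theta>) * g \<theta>)
      = energy W f - energy W g"
    unfolding energy_def using int' by (simp add: left_diff_distrib right_diff_distrib)
  moreover have "\<bar>LINT \<theta>|circle. potential W f \<theta> * (f \<theta> - g \<theta>)\<bar> \<le> B * ?d"
    using int assms by (intro abs_integral_bounded_times_le potential_bound_density) auto
  moreover have "\<bar>LINT \<theta>|circle. (potential W f \<theta> - potential W g \<theta>) * g \<theta>\<bar> \<le> B * ?d * (LINT \<theta>|circle. \<bar>g \<theta>\<bar>)"
    using int assms by (intro abs_integral_bounded_times_le potential_dist) auto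
  ultimately show ?thesis
    using prob_density_abs_integral[OF assms(2)] by simp
qed

text \<open>The second-order term of the quadratic form \<open>energy W\<close> along the segment is
  \<open>t\<^sup>2\<close> times the energy of the signed density \<open>g - f\<close>, of size at most \<open>4 B\<close>.\<close>

lemma energy_mix:
  assumes "prob_density f" "prob_density g"
  shows "energy W (\<lambda>\<theta>. (1 - t) * f \<theta> + t * g \<theta>)
    \<ge> energy W f + 2 * t * (LINT \<theta>|circle. potential W f \<theta> * g \<theta>) - 2 * t * energy W f - 4 * B * t\<^sup>2"
proof -
  let ?c = "LINT \<theta>|circle. potential W f \<theta> * g \<theta>"
  have int: "integrable circle f" "integrable circle g"
    using assms by (simp_all add: prob_density_def)
  note int' = integrable_potential[OF int(1) int(1)] integrable_potential[OF int(1) int(2)]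
    integrable_potential[OF int(2) int(1)] integrable_potential[OF int(2) int(2)]
  have "energy W (\<lambda>\<theta>. (1 - t) * f \<theta> + t * g \<theta>)
      = (LINT \<theta>|circle. (1 - t)\<^sup>2 * (potential W f \<theta> * f \<theta>) + (1 - t) * t * (potential W f \<theta> * g \<theta>)
          + (1 - t) * t * (potential W g \<theta> * f \<theta>) + t\<^sup>2 * (potential W g \<theta> * g \<theta>))"
    unfolding energy_def potential_mix[OF int]
    by (intro Bochner_Integration.integral_cong) (auto simp: power2_eq_square algebra_simps)
  also have "\<dots> = (1 - t)\<^sup>2 * energy W f + (1 - t) * t * ?c + (1 - t) * t * ?c + t\<^sup>2 * energy W g"
    using int' potential_symmetric[OF int(2,1)] by (simp add: energy_def)
  also have "\<dots> = energy W f + 2 * t * ?c - 2 * t * energy W f + t\<^sup>2 * (energy W f - 2 * ?c + energy W g)"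
    by (simp add: power2_eq_square algebra_simps)
  finally have expand: "energy W (\<lambda>\<theta>. (1 - t) * f \<theta> + t * g \<theta>) = \<dots>" .
  have "\<bar>?c\<bar> \<le> B * (LINT \<theta>|circle. \<bar>g \<theta>\<bar>)"
    using int assms by (intro abs_integral_bounded_times_le potential_bound_density) auto
  then have "- 4 * B \<le> energy W f - 2 * ?c + energy W g"
    using energy_bound[OF assms(1)] energy_bound[OF assms(2)] prob_density_abs_integral[OF assms(2)]
    by simp
  then have "t\<^sup>2 * (- 4 * B) \<le> t\<^sup>2 * (energy W f - 2 * ?c + energy W g)"
    by (rule mult_left_mono) simp
  then show ?thesis
    unfolding expand by (simp add: mult_ac)
qed

text \<open>Moving from \<open>f\<close> a distance \<open>t\<close> towards the Gibbs density \<open>\<sigma>\<close> of its own potential lowers the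
  linearised free energy by at least \<open>t\<close> times the relative entropy of \<open>f\<close>, since this linearised functional
  is minimal exactly at \<open>\<sigma>\<close>. The entropy lies below its chord and the interaction energy adds an
  error \<open>2 \<kappa> B t\<^sup>2\<close>, so a density whose free energy is within \<open>t\<^sup>2\<close> of the minimum has relative
  entropy of order \<open>t\<close> only.\<close>

lemma relative_entropy_le_gap:
  assumes "0 \<le> \<kappa>" "prob_density f" "finite_entropy f" "0 < t" "t \<le> 1"
    and near_min: "\<And>g. \<lbrakk>prob_density g; finite_entropy g\<rbrakk> \<Longrightarrow>
      neg_entropy f - \<kappa> / 2 * energy W f \<le> neg_entropy g - \<kappa> / 2 * energy W g + t\<^sup>2"
  shows "relative_entropy \<kappa> (potential W f) f \<le> (1 + 2 * \<kappa> * B) * t"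
proof -
  let ?V = "potential W f" and ?\<sigma> = "gibbs \<kappa> (potential W f)"
  let ?h = "\<lambda>\<theta>. (1 - t) * f \<theta> + t * ?\<sigma> \<theta>" and ?c = "LINT \<theta>|circle. potential W f \<theta> * ?\<sigma> \<theta>"
  have f: "integrable circle f"
    using assms by (simp add: prob_density_def)
  have V: "?V \<in> borel_measurable borel" "\<And>\<theta>. \<bar>?V \<theta>\<bar> \<le> B"
    using potential_measurable[OF f] potential_bound_density[OF assms(2)] by auto
  note \<sigma> = prob_density_gibbs[OF V] finite_entropy_gibbs[OF V]
  have h: "prob_density ?h" "finite_entropy ?h"
      "neg_entropy ?h \<le> (1 - t) * neg_entropy f + t * neg_entropy ?\<sigma>"
    using assms \<sigma> by (auto intro!: prob_density_mix neg_entropy_mix)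
  have "neg_entropy f - \<kappa> / 2 * energy W f \<le> neg_entropy ?h - \<kappa> / 2 * energy W ?h + t\<^sup>2"
    by (rule near_min[OF h(1,2)])
  also have "\<dots> \<le> ((1 - t) * neg_entropy f + t * neg_entropy ?\<sigma>)
      - \<kappa> / 2 * (energy W f + 2 * t * ?c - 2 * t * energy W f - 4 * B * t\<^sup>2) + t\<^sup>2"
    using energy_mix[OF assms(2) \<sigma>(1), of t] assms(1) h(3)
    by (intro add_mono diff_mono mult_left_mono) auto
  also have "\<dots> = neg_entropy f - \<kappa> / 2 * energy W f
      - t * (relative_entropy \<kappa> ?V f - relative_entropy \<kappa> ?V ?\<sigma>) + t * ((1 + 2 * \<kappa> * B) * t)"
    by (simp add: relative_entropy_def energy_def algebra_simps power2_eq_square)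
  finally have "t * relative_entropy \<kappa> ?V f \<le> t * ((1 + 2 * \<kappa> * B) * t)"
    using relative_entropy_gibbs[OF V] by simp
  then show ?thesis
    using assms(4) by (simp only: mult_le_cancel_left_pos)
qed

end

section \<open>Compactness of near-minimizers\<close>

context interaction_kernel
begin

text \<open>Convolving with a probability density does not increase the modulus of continuity of \<open>W\<close>; for
  \<open>x\<close> and \<open>\<phi>\<close> in one period only the values of \<open>W\<close> on \<open>[-2\<pi>, 2\<pi>]\<close> occur.\<close>

lemma potentials_equicontinuous:
  assumes "x \<in> {0..2 * pi}" "0 < e"
  shows "\<exists>d>0. \<forall>f y. prob_density f \<longrightarrow> y \<in> {0..2 * pi} \<and> norm (x - y) < d \<longrightarrow>
    norm (potential W f x - potential W f y) < e"
proof -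
  have "uniformly_continuous_on {- (2 * pi)..2 * pi} W"
    using W_continuous by (intro compact_uniformly_continuous) (auto intro: continuous_on_subset)
  then obtain d where d: "0 < d"
      "\<And>u v. \<lbrakk>u \<in> {- (2 * pi)..2 * pi}; v \<in> {- (2 * pi)..2 * pi}; dist v u < d\<rbrakk> \<Longrightarrow> dist (W v) (W u) < e / 2"
    unfolding uniformly_continuous_on_def using half_gt_zero[OF assms(2)] by metis
  have "norm (potential W f x - potential W f y) < e"
    if f: "prob_density f" and y: "y \<in> {0..2 * pi}" "norm (x - y) < d" for f y
  proof -
    have int: "integrable circle f"
      using f by (simp add: prob_density_def)
    have "potential W f x - potential W f y = (LINT \<phi>|circle. (W (x - \<phi>) - W (y - \<phi>)) * f \<phi>)"
      unfolding potential_def using integrable_kernel[OF int] by (simp add: left_diff_distrib)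
    also have "\<bar>\<dots>\<bar> \<le> (LINT \<phi>|circle. \<bar>(W (x - \<phi>) - W (y - \<phi>)) * f \<phi>\<bar>)"
      by (rule integral_abs_bound)
    also have "\<dots> \<le> (LINT \<phi>|circle. e / 2 * \<bar>f \<phi>\<bar>)"
    proof (rule integral_mono_AE)
      show "integrable circle (\<lambda>\<phi>. \<bar>(W (x - \<phi>) - W (y - \<phi>)) * f \<phi>\<bar>)"
        unfolding left_diff_distrib using integrable_kernel[OF int] by simp
      show "AE \<phi> in circle. \<bar>(W (x - \<phi>) - W (y - \<phi>)) * f \<phi>\<bar> \<le> e / 2 * \<bar>f \<phi>\<bar>"
        using AE_circle
      proof eventually_elim
        case (elim \<phi>)
        then have "dist (W (x - \<phi>)) (W (y - \<phi>)) < e / 2"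
          using assms(1) y by (intro d(2)) (auto simp: dist_real_def)
        then show ?case
          unfolding dist_real_def abs_mult by (intro mult_right_mono) auto
      qed
    qed (use int in simp)
    also have "\<dots> = e / 2"
      using prob_density_abs_integral[OF f] by simp
    finally show ?thesis
      using assms(2) by simp
  qed
  with d(1) show ?thesis by blast
qed

lemma potentials_precompact:
  assumes "\<And>n. prob_density (fs n)"
  obtains V r where "V \<in> borel_measurable borel" "\<forall>\<theta>. \<bar>V \<theta>\<bar> \<le> B" "strict_mono (r :: nat \<Rightarrow> nat)"
    "\<forall>\<theta>\<in>{0..2 * pi}. (\<lambda>n. potential W (fs (r n)) \<theta>) \<longlonglongrightarrow> V \<theta>"
proof -
  let ?S = "{0..2 * pi}"
  have equi: "\<exists>d>0. \<forall>n y. y \<in> ?S \<and> norm (x - y) < d \<longrightarrow>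
      norm (potential W (fs n) x - potential W (fs n) y) < e" if "x \<in> ?S" "0 < e" for x e
    using potentials_equicontinuous[OF that] assms by blast
  obtain g r where g: "continuous_on ?S g" "strict_mono (r :: nat \<Rightarrow> nat)"
    "\<And>e. 0 < e \<Longrightarrow> \<exists>N. \<forall>n x. N \<le> n \<and> x \<in> ?S \<longrightarrow> norm (potential W (fs (r n)) x - g x) < e"
    using Arzela_Ascoli[of ?S "\<lambda>n. potential W (fs n)" B] equi potential_bound_density[OF assms]
    by (metis compact_Icc real_norm_def)
  have lim: "(\<lambda>n. potential W (fs (r n)) x) \<longlonglongrightarrow> g x" if "x \<in> ?S" for x
    using g(3) that by (intro LIMSEQ_I) blast
  show ?thesis
  proof (rule that)
    \<comment> \<open>Extension by \<open>0\<close> makes the limit a bounded Borel function on the whole line.\<close>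
    let ?V = "\<lambda>x. indicator ?S x *\<^sub>R g x"
    show "?V \<in> borel_measurable borel"
      using g(1) by (intro borel_measurable_continuous_on_indicator) auto
    show "\<forall>x. \<bar>?V x\<bar> \<le> B"
    proof
      fix x show "\<bar>?V x\<bar> \<le> B"
      proof (cases "x \<in> ?S")
        case True
        have "\<bar>g x\<bar> \<le> B"
          using tendsto_rabs[OF lim[OF True]] potential_bound_density[OF assms]
          by (intro LIMSEQ_le_const2) auto
        then show ?thesis using True by simp
      qed (simp add: B_nonneg)
    qed
    show "\<forall>x\<in>?S. (\<lambda>n. potential W (fs (r n)) x) \<longlonglongrightarrow> ?V x"
      using lim by simp
  qed (rule g(2))
qed

lemma gibbs_convergence:
  assumes Vs: "\<And>n. Vs n \<in> borel_measurable borel" "\<And>n \<theta>. \<bar>Vs n \<theta>\<bar> \<le> C"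
    and V: "V \<in> borel_measurable borel" "\<And>\<theta>. \<bar>V \<theta>\<bar> \<le> C"
    and lim: "\<And>\<theta>. \<theta> \<in> {0..2 * pi} \<Longrightarrow> (\<lambda>n. Vs n \<theta>) \<longlonglongrightarrow> V \<theta>"
    and \<kappa>s: "\<kappa>s \<longlonglongrightarrow> \<kappa>"
  shows "(\<lambda>n. partition_function (\<kappa>s n) (Vs n)) \<longlonglongrightarrow> partition_function \<kappa> V"
    and "(\<lambda>n. LINT \<theta>|circle. \<bar>gibbs (\<kappa>s n) (Vs n) \<theta> - gibbs \<kappa> V \<theta>\<bar>) \<longlonglongrightarrow> 0"
proof -
  note Vs(1)[measurable] V(1)[measurable]
  have "0 \<le> C"
    using V(2)[of 0] by simp
  have "Bseq \<kappa>s"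
    using \<kappa>s by (auto intro: convergent_imp_Bseq convergentI)
  then obtain K where K: "\<And>n. \<bar>\<kappa>s n\<bar> \<le> K"
    unfolding Bseq_def by auto
  have KC: "\<bar>\<kappa>s n\<bar> * C \<le> K * C" for n
    using K \<open>0 \<le> C\<close> by (intro mult_right_mono)
  have S: "AE \<theta> in circle. \<theta> \<in> {0..2 * pi}"
    using AE_circle by eventually_elim auto
  have exp_lim: "(\<lambda>n. exp (\<kappa>s n * Vs n \<theta>)) \<longlonglongrightarrow> exp (\<kappa> * V \<theta>)" if "\<theta> \<in> {0..2 * pi}" for \<theta>
    using lim[OF that] \<kappa>s by (intro tendsto_intros)
  show Z: "(\<lambda>n. partition_function (\<kappa>s n) (Vs n)) \<longlonglongrightarrow> partition_function \<kappa> V"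
    unfolding partition_function_def
  proof (rule integral_dominated_convergence[where w = "\<lambda>_. exp (K * C)"])
    show "AE \<theta> in circle. (\<lambda>n. exp (\<kappa>s n * Vs n \<theta>)) \<longlonglongrightarrow> exp (\<kappa> * V \<theta>)"
      using S by eventually_elim (rule exp_lim)
    show "AE \<theta> in circle. norm (exp (\<kappa>s n * Vs n \<theta>)) \<le> exp (K * C)" for n
    proof (rule AE_I2)
      fix \<theta>
      have "exp (\<kappa>s n * Vs n \<theta>) \<le> exp (\<bar>\<kappa>s n\<bar> * C)"
        using Vs by (intro exp_potential_bounds) auto
      also have "\<dots> \<le> exp (K * C)"
        using KC by simp
      finally show "norm (exp (\<kappa>s n * Vs n \<theta>)) \<le> exp (K * C)" by simp
    qed
  qed simp_all
  have Zpos: "partition_function \<kappa> V \<noteq> 0"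
    using partition_function_pos[OF V, of \<kappa>] by simp
  have "(\<lambda>n. LINT \<theta>|circle. \<bar>gibbs (\<kappa>s n) (Vs n) \<theta> - gibbs \<kappa> V \<theta>\<bar>) \<longlonglongrightarrow> (LINT \<theta>|circle. 0)"
  proof (rule integral_dominated_convergence[where w = "\<lambda>_. exp (2 * (K * C)) + exp (2 * (\<bar>\<kappa>\<bar> * C))"])
    show "AE \<theta> in circle. (\<lambda>n. \<bar>gibbs (\<kappa>s n) (Vs n) \<theta> - gibbs \<kappa> V \<theta>\<bar>) \<longlonglongrightarrow> 0"
      using S
    proof eventually_elim
      case (elim \<theta>)
      have "(\<lambda>n. gibbs (\<kappa>s n) (Vs n) \<theta>) \<longlonglongrightarrow> gibbs \<kappa> V \<theta>"
        unfolding gibbs_def by (intro tendsto_divide exp_lim elim Z Zpos)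
      then show ?case
        by (intro tendsto_rabs_zero LIM_zero)
    qed
    show "AE \<theta> in circle. norm \<bar>gibbs (\<kappa>s n) (Vs n) \<theta> - gibbs \<kappa> V \<theta>\<bar>
        \<le> exp (2 * (K * C)) + exp (2 * (\<bar>\<kappa>\<bar> * C))" for n
    proof (rule AE_I2)
      fix \<theta>
      have "gibbs (\<kappa>s n) (Vs n) \<theta> \<le> exp (2 * (\<bar>\<kappa>s n\<bar> * C))"
        using Vs by (intro gibbs_le) auto
      also have "\<dots> \<le> exp (2 * (K * C))"
        using KC by simp
      finally have "gibbs (\<kappa>s n) (Vs n) \<theta> \<le> exp (2 * (K * C))" .
      moreover have "0 < gibbs (\<kappa>s n) (Vs n) \<theta>" "0 < gibbs \<kappa> V \<theta>" "gibbs \<kappa> V \<theta> \<le> exp (2 * (\<bar>\<kappa>\<bar> * C))"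
        using gibbs_pos[OF Vs(1,2)] gibbs_pos[OF V] gibbs_le[OF V] by auto
      ultimately show "norm \<bar>gibbs (\<kappa>s n) (Vs n) \<theta> - gibbs \<kappa> V \<theta>\<bar>
          \<le> exp (2 * (K * C)) + exp (2 * (\<bar>\<kappa>\<bar> * C))"
        unfolding real_norm_def by linarith
    qed
  qed (use gibbs_measurable Vs V in \<open>simp_all\<close>)
  then show "(\<lambda>n. LINT \<theta>|circle. \<bar>gibbs (\<kappa>s n) (Vs n) \<theta> - gibbs \<kappa> V \<theta>\<bar>) \<longlonglongrightarrow> 0"
    by simp
qed

abbreviation free :: "real \<Rightarrow> (real \<Rightarrow> real) \<Rightarrow> real"
  where "free \<kappa> f \<equiv> neg_entropy f - \<kappa> / 2 * energy W f"

text \<open>Near-minimizers are \<open>L\<^sup>1\<close>-close to the Gibbs densities of their potentials, and these converge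
  along a subsequence because the potentials are precompact in the uniform topology. The limit is
  a minimizer since the entropies converge as well: the entropy is an affine function of the relative
  entropy, which tends to \<open>0\<close>, and of quantities continuous in \<open>L\<^sup>1\<close>.

  With a constant \<open>\<kappa>\<close> the statement gives existence of minimizers; with exact minimizers
  at varying parameters it gives compactness of the minimizers and closedness of their graph.\<close>

lemma near_minimizers_precompact:
  assumes \<kappa>: "\<And>n. 0 < \<kappa>s n" "\<kappa>s \<longlonglongrightarrow> \<kappa>"
    and fs: "\<And>n. prob_density (fs n)" "\<And>n. finite_entropy (fs n)"
    and t: "\<And>n. 0 < t n" "\<And>n. t n \<le> 1" "t \<longlonglongrightarrow> 0"
    and near_min: "\<And>n g. \<lbrakk>prob_density g; finite_entropy g\<rbrakk> \<Longrightarrow>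
      free (\<kappa>s n) (fs n) \<le> free (\<kappa>s n) g + (t n)\<^sup>2"
  obtains r \<sigma> where "strict_mono (r :: nat \<Rightarrow> nat)" "prob_density \<sigma>" "finite_entropy \<sigma>"
    "(\<lambda>n. LINT \<theta>|circle. \<bar>fs (r n) \<theta> - \<sigma> \<theta>\<bar>) \<longlonglongrightarrow> 0"
    "(\<lambda>n. energy W (fs (r n))) \<longlonglongrightarrow> energy W \<sigma>"
    "\<forall>g. prob_density g \<and> finite_entropy g \<longrightarrow> free \<kappa> \<sigma> \<le> free \<kappa> g"
proof -
  let ?S = "{0..2 * pi}"
  define Vs where "Vs n = potential W (fs n)" for n
  define \<sigma>s where "\<sigma>s n = gibbs (\<kappa>s n) (Vs n)" for n
  define R where "R n = relative_entropy (\<kappa>s n) (Vs n) (fs n)" for n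
  have int: "integrable circle (fs n)" for n
    using fs(1) by (simp add: prob_density_def)
  have Vs: "Vs n \<in> borel_measurable borel" "\<bar>Vs n \<theta>\<bar> \<le> B" for n \<theta>
    unfolding Vs_def using potential_measurable[OF int] potential_bound_density[OF fs(1)] by auto
  have "Bseq \<kappa>s"
    using \<kappa>(2) by (auto intro: convergent_imp_Bseq convergentI)
  then obtain K where K: "\<And>n. \<bar>\<kappa>s n\<bar> \<le> K"
    unfolding Bseq_def by auto
  define c where "c = 1 + 2 * K * B"
  have R_nonneg: "0 \<le> R n" for n
    unfolding R_def by (rule relative_entropy_nonneg[OF Vs fs])
  have R_le: "R n \<le> c * t n" for n
  proof -
    have "R n \<le> (1 + 2 * \<kappa>s n * B) * t n"
      unfolding R_def Vs_def using \<kappa>(1) fs t near_min by (intro relative_entropy_le_gap) (auto intro: less_imp_le)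
    also have "\<dots> \<le> c * t n"
      unfolding c_def using K[of n] B_nonneg t(1)[of n] by (intro mult_right_mono add_mono) auto
    finally show ?thesis .
  qed
  have R_lim: "R \<longlonglongrightarrow> 0"
    using R_nonneg R_le tendsto_mult_right_zero[OF t(3), of c]
    by (intro tendsto_sandwich[of "\<lambda>_. 0" R sequentially "\<lambda>n. c * t n"]) auto
  \<comment> \<open>The choice \<open>e = \<surd>t\<close> balances the two terms of the Pinsker-type bound.\<close>
  have dist_lim: "(\<lambda>n. LINT \<theta>|circle. \<bar>fs n \<theta> - \<sigma>s n \<theta>\<bar>) \<longlonglongrightarrow> 0"
  proof (rule tendsto_sandwich[of "\<lambda>_. 0" _ sequentially "\<lambda>n. (c / 2 + 2) * sqrt (t n)"])
    have "(LINT \<theta>|circle. \<bar>fs n \<theta> - \<sigma>s n \<theta>\<bar>) \<le> (c / 2 + 2) * sqrt (t n)" for n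
    proof -
      have "(LINT \<theta>|circle. \<bar>fs n \<theta> - \<sigma>s n \<theta>\<bar>) \<le> R n / (2 * sqrt (t n)) + 2 * sqrt (t n)"
        unfolding \<sigma>s_def R_def using t(1) by (intro L1_dist_gibbs_le[OF Vs] fs) auto
      also have "R n / (2 * sqrt (t n)) \<le> c * t n / (2 * sqrt (t n))"
        using R_le t(1)[of n] by (intro divide_right_mono) auto
      also have "\<dots> = c / 2 * sqrt (t n)"
      proof -
        have "c * t n / (2 * sqrt (t n)) = c / 2 * (t n / sqrt (t n))"
          by simp
        then show ?thesis
          using real_div_sqrt[of "t n"] t(1)[of n] by simp
      qed
      finally show ?thesis by (simp add: algebra_simps)
    qed
    then show "\<forall>\<^sub>F n in sequentially. (LINT \<theta>|circle. \<bar>fs n \<theta> - \<sigma>s n \<theta>\<bar>) \<le> (c / 2 + 2) * sqrt (t n)"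
      by simp
    show "(\<lambda>n. (c / 2 + 2) * sqrt (t n)) \<longlonglongrightarrow> 0"
      using tendsto_mult_right_zero[OF tendsto_real_sqrt[OF t(3), simplified]] by blast
  qed simp_all
  obtain V r where V_meas: "V \<in> borel_measurable borel" and V_bound: "\<forall>\<theta>. \<bar>V \<theta>\<bar> \<le> B"
    and r: "strict_mono (r :: nat \<Rightarrow> nat)" and V_lim': "\<forall>\<theta>\<in>?S. (\<lambda>n. Vs (r n) \<theta>) \<longlonglongrightarrow> V \<theta>"
    using potentials_precompact[of fs, OF fs(1), folded Vs_def] .
  note V = V_meas V_bound[rule_format] and V_lim = V_lim'[rule_format]
  have \<kappa>r: "(\<lambda>n. \<kappa>s (r n)) \<longlonglongrightarrow> \<kappa>"
    using LIMSEQ_subseq_LIMSEQ[OF \<kappa>(2) r] by (simp add: o_def)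
  define \<sigma> where "\<sigma> = gibbs \<kappa> V"
  have \<sigma>: "prob_density \<sigma>" "finite_entropy \<sigma>"
    unfolding \<sigma>_def by (rule prob_density_gibbs[OF V] finite_entropy_gibbs[OF V])+
  then have int_\<sigma>: "integrable circle \<sigma>"
    by (simp add: prob_density_def)
  have Z_lim: "(\<lambda>n. partition_function (\<kappa>s (r n)) (Vs (r n))) \<longlonglongrightarrow> partition_function \<kappa> V"
    by (rule gibbs_convergence(1)[OF Vs V V_lim \<kappa>r])
  have \<sigma>_lim: "(\<lambda>n. LINT \<theta>|circle. \<bar>\<sigma>s (r n) \<theta> - \<sigma> \<theta>\<bar>) \<longlonglongrightarrow> 0"
    unfolding \<sigma>s_def \<sigma>_def by (rule gibbs_convergence(2)[OF Vs V V_lim \<kappa>r])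
  have L1_lim: "(\<lambda>n. LINT \<theta>|circle. \<bar>fs (r n) \<theta> - \<sigma> \<theta>\<bar>) \<longlonglongrightarrow> 0"
  proof (rule tendsto_sandwich[of "\<lambda>_. 0" _ sequentially
        "\<lambda>n. (LINT \<theta>|circle. \<bar>fs (r n) \<theta> - \<sigma>s (r n) \<theta>\<bar>) + (LINT \<theta>|circle. \<bar>\<sigma>s (r n) \<theta> - \<sigma> \<theta>\<bar>)"])
    have "(LINT \<theta>|circle. \<bar>fs n \<theta> - \<sigma> \<theta>\<bar>)
        \<le> (LINT \<theta>|circle. \<bar>fs n \<theta> - \<sigma>s n \<theta>\<bar>) + (LINT \<theta>|circle. \<bar>\<sigma>s n \<theta> - \<sigma> \<theta>\<bar>)" for n
    proof -
      have int': "integrable circle (\<sigma>s n)"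
        unfolding \<sigma>s_def using prob_density_gibbs[OF Vs] by (simp add: prob_density_def)
      have "(LINT \<theta>|circle. \<bar>fs n \<theta> - \<sigma> \<theta>\<bar>) \<le> (LINT \<theta>|circle. \<bar>fs n \<theta> - \<sigma>s n \<theta>\<bar> + \<bar>\<sigma>s n \<theta> - \<sigma> \<theta>\<bar>)"
        using int int_\<sigma> int' by (intro integral_mono) auto
      then show ?thesis
        using int int_\<sigma> int' by simp
    qed
    then show "\<forall>\<^sub>F n in sequentially. (LINT \<theta>|circle. \<bar>fs (r n) \<theta> - \<sigma> \<theta>\<bar>)
        \<le> (LINT \<theta>|circle. \<bar>fs (r n) \<theta> - \<sigma>s (r n) \<theta>\<bar>) + (LINT \<theta>|circle. \<bar>\<sigma>s (r n) \<theta> - \<sigma> \<theta>\<bar>)"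
      by simp
    show "(\<lambda>n. (LINT \<theta>|circle. \<bar>fs (r n) \<theta> - \<sigma>s (r n) \<theta>\<bar>) + (LINT \<theta>|circle. \<bar>\<sigma>s (r n) \<theta> - \<sigma> \<theta>\<bar>)) \<longlonglongrightarrow> 0"
      using tendsto_add[OF LIMSEQ_subseq_LIMSEQ[OF dist_lim r] \<sigma>_lim] by (simp add: o_def)
  qed simp_all
  have E_lim: "(\<lambda>n. energy W (fs (r n))) \<longlonglongrightarrow> energy W \<sigma>"
  proof (rule LIM_zero_cancel, rule Lim_null_comparison)
    show "\<forall>\<^sub>F n in sequentially. norm (energy W (fs (r n)) - energy W \<sigma>)
        \<le> 2 * B * (LINT \<theta>|circle. \<bar>fs (r n) \<theta> - \<sigma> \<theta>\<bar>)"
      using energy_dist[OF fs(1) \<sigma>(1)] by simp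
  qed (rule tendsto_mult_right_zero[OF L1_lim])
  \<comment> \<open>The limit potential is generated by the limit density, so \<open>\<sigma>\<close> is a Gibbs density of its own
    potential.\<close>
  have V_eq: "V \<theta> = potential W \<sigma> \<theta>" if "\<theta> \<in> ?S" for \<theta>
  proof (rule LIMSEQ_unique[OF V_lim[OF that]])
    show "(\<lambda>n. Vs (r n) \<theta>) \<longlonglongrightarrow> potential W \<sigma> \<theta>"
    proof (rule LIM_zero_cancel, rule Lim_null_comparison)
      show "\<forall>\<^sub>F n in sequentially. norm (Vs (r n) \<theta> - potential W \<sigma> \<theta>)
          \<le> B * (LINT \<theta>|circle. \<bar>fs (r n) \<theta> - \<sigma> \<theta>\<bar>)"
        unfolding Vs_def using potential_dist[OF int int_\<sigma>] by simp
    qed (rule tendsto_mult_right_zero[OF L1_lim])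
  qed
  have "(LINT \<theta>|circle. V \<theta> * \<sigma> \<theta>) = energy W \<sigma>"
    unfolding energy_def
  proof (rule integral_cong_AE)
    show "AE \<theta> in circle. V \<theta> * \<sigma> \<theta> = potential W \<sigma> \<theta> * \<sigma> \<theta>"
      using AE_circle by eventually_elim (simp add: V_eq)
  qed (use V(1) potential_measurable[OF int_\<sigma>] prob_density_measurable[OF \<sigma>(1)] in simp_all)
  with relative_entropy_gibbs[OF V, of \<kappa>]
  have entropy_\<sigma>: "neg_entropy \<sigma> = \<kappa> * energy W \<sigma> - ln (partition_function \<kappa> V)"
    by (simp add: relative_entropy_def \<sigma>_def)
  have entropy_fs: "neg_entropy (fs n) = R n + \<kappa>s n * energy W (fs n) - ln (partition_function (\<kappa>s n) (Vs n))" for n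
    by (simp add: R_def relative_entropy_def energy_def Vs_def)
  have "(\<lambda>n. R (r n) + \<kappa>s (r n) * energy W (fs (r n)) - ln (partition_function (\<kappa>s (r n)) (Vs (r n))))
      \<longlonglongrightarrow> 0 + \<kappa> * energy W \<sigma> - ln (partition_function \<kappa> V)"
    using LIMSEQ_subseq_LIMSEQ[OF R_lim r] partition_function_pos[OF V, of \<kappa>]
    by (intro tendsto_intros \<kappa>r E_lim Z_lim) (auto simp: o_def)
  then have free_lim: "(\<lambda>n. free (\<kappa>s (r n)) (fs (r n))) \<longlonglongrightarrow> free \<kappa> \<sigma>"
    unfolding entropy_fs[symmetric] by (intro tendsto_intros \<kappa>r E_lim) (simp_all add: entropy_\<sigma>)
  have "free \<kappa> \<sigma> \<le> free \<kappa> g" if g: "prob_density g" "finite_entropy g" for g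
  proof (rule LIMSEQ_le[OF free_lim])
    have "(\<lambda>n. free (\<kappa>s (r n)) g + (t (r n))\<^sup>2) \<longlonglongrightarrow> free \<kappa> g + 0\<^sup>2"
      using LIMSEQ_subseq_LIMSEQ[OF t(3) r] by (intro tendsto_intros \<kappa>r) (auto simp: o_def)
    then show "(\<lambda>n. free (\<kappa>s (r n)) g + (t (r n))\<^sup>2) \<longlonglongrightarrow> free \<kappa> g"
      by simp
    show "\<exists>N. \<forall>n\<ge>N. free (\<kappa>s (r n)) (fs (r n)) \<le> free (\<kappa>s (r n)) g + (t (r n))\<^sup>2"
      using near_min[OF g] by blast
  qed
  then show ?thesis
    by (intro that[OF r \<sigma> L1_lim E_lim]) blast
qed

end

section \<open>Minimizers as elements of \<open>L\<^sup>1\<close>\<close>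

lemma integrable_rep_L1: "integrable circle (rep_circle_L1 \<rho>)"
  using Quotient_rep_reflp[OF Quotient_circle_L1, of \<rho>] by (simp add: L1_rel_def)

lemma rep_abs_L1:
  assumes "integrable circle f" shows "AE \<theta> in circle. rep_circle_L1 (abs_circle_L1 f) \<theta> = f \<theta>"
proof -
  have "L1_rel f f"
    using assms by (simp add: L1_rel_def)
  from Quotient_rep_abs[OF Quotient_circle_L1, OF this] show ?thesis
    by (simp add: L1_rel_def)
qed

lemma dist_L1_rep: "dist \<rho> \<sigma> = (LINT \<theta>|circle. \<bar>rep_circle_L1 \<rho> \<theta> - rep_circle_L1 \<sigma> \<theta>\<bar>)"
  using dist_circle_L1.abs_eq[OF Quotient_rep_reflp[OF Quotient_circle_L1, of \<rho>]
      Quotient_rep_reflp[OF Quotient_circle_L1, of \<sigma>]]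
  by (simp add: Quotient_abs_rep[OF Quotient_circle_L1])

lemma pos_densities_eq: "pos_densities = {\<rho>. prob_density (rep_circle_L1 \<rho>)}"
  by (simp add: pos_densities_def prob_density_def integrable_rep_L1)

lemma interaction_energy_eq: "interaction_energy W \<rho> = energy W (rep_circle_L1 \<rho>)"
proof -
  have "(LINT \<phi>|circle. W (\<theta> - \<phi>) * rep_circle_L1 \<rho> \<theta> * rep_circle_L1 \<rho> \<phi>)
      = potential W (rep_circle_L1 \<rho>) \<theta> * rep_circle_L1 \<rho> \<theta>" for \<theta>
  proof -
    have "(\<lambda>\<phi>. W (\<theta> - \<phi>) * rep_circle_L1 \<rho> \<theta> * rep_circle_L1 \<rho> \<phi>)
        = (\<lambda>\<phi>. W (\<theta> - \<phi>) * rep_circle_L1 \<rho> \<phi> * rep_circle_L1 \<rho> \<theta>)"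
      by (simp add: fun_eq_iff)
    then show ?thesis
      by (simp add: potential_def)
  qed
  then show ?thesis
    by (simp add: interaction_energy_def energy_def)
qed

text \<open>The classes on which the free energy is finite. Infinite values never compete for the minimum,
  so on this set the problem is one about real numbers.\<close>

definition admissible :: "circle_L1 set"
  where "admissible = {\<rho>. prob_density (rep_circle_L1 \<rho>) \<and> finite_entropy (rep_circle_L1 \<rho>)}"

text \<open>A density is passed to its class in \<open>L\<^sup>1\<close>, whose chosen representative agrees with it only
  almost everywhere; the functionals do not see the difference.\<close>

lemma admissible_class_exists:
  assumes f: "prob_density f" "finite_entropy f"
  obtains \<rho> where "\<rho> \<in> admissible" "AE \<theta> in circle. rep_circle_L1 \<rho> \<theta> = f \<theta>"
    "neg_entropy (rep_circle_L1 \<rho>) = neg_entropy f"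
proof
  let ?\<rho> = "abs_circle_L1 f"
  let ?g = "rep_circle_L1 ?\<rho>"
  have int: "integrable circle f"
    using f by (simp add: prob_density_def)
  have [measurable]: "f \<in> borel_measurable borel" "?g \<in> borel_measurable borel"
    using borel_measurable_integrable[OF int] borel_measurable_integrable[OF integrable_rep_L1] by simp_all
  show eq: "AE \<theta> in circle. ?g \<theta> = f \<theta>"
    by (rule rep_abs_L1[OF int])
  then have eq_ln: "AE \<theta> in circle. ?g \<theta> * ln (?g \<theta>) = f \<theta> * ln (f \<theta>)"
    by eventually_elim simp
  show "neg_entropy ?g = neg_entropy f"
    unfolding neg_entropy_def using eq_ln by (intro integral_cong_AE) auto
  have "finite_entropy ?g"
    using f(2) eq_ln unfolding finite_entropy_def by (subst integrable_cong_AE) auto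
  moreover have "AE \<theta> in circle. 0 < ?g \<theta>"
    using eq f(1)[unfolded prob_density_def] by (auto elim: eventually_elim2)
  moreover have "(LINT \<theta>|circle. ?g \<theta>) = (LINT \<theta>|circle. f \<theta>)"
    using eq by (intro integral_cong_AE) auto
  ultimately show "?\<rho> \<in> admissible"
    using f(1) integrable_rep_L1 by (simp add: admissible_def prob_density_def)
qed

context interaction_kernel
begin

lemma energy_cong_AE:
  assumes "prob_density f" "prob_density g" "AE \<theta> in circle. f \<theta> = g \<theta>"
  shows "energy W f = energy W g"
proof -
  have "(LINT \<theta>|circle. \<bar>f \<theta> - g \<theta>\<bar>) = (LINT \<theta>|circle. 0)"
    using assms(3) prob_density_measurable[OF assms(1)] prob_density_measurable[OF assms(2)]
    by (intro integral_cong_AE) (auto elim: eventually_mono)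
  then show ?thesis
    using energy_dist[OF assms(1,2)] by simp
qed

abbreviation free_L1 :: "real \<Rightarrow> circle_L1 \<Rightarrow> real"
  where "free_L1 \<kappa> \<rho> \<equiv> free \<kappa> (rep_circle_L1 \<rho>)"

lemma free_energy_eq:
  "\<rho> \<in> pos_densities \<Longrightarrow>
    free_energy W \<rho> \<kappa> = (if \<rho> \<in> admissible then ereal (free_L1 \<kappa> \<rho>) else \<infinity>)"
  by (simp add: free_energy_def entropy_term_def pos_densities_eq admissible_def finite_entropy_def
      neg_entropy_def interaction_energy_eq)

lemma admissible_subset: "admissible \<subseteq> pos_densities"
  by (auto simp: admissible_def pos_densities_eq)

lemma admissible_nonempty: "admissible \<noteq> {}"
proof -
  have "prob_density (\<lambda>_. 1)" "finite_entropy (\<lambda>_. 1)"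
    by (simp_all add: prob_density_def finite_entropy_def circle.prob_space[simplified])
  then show ?thesis
    by (rule admissible_class_exists) blast
qed

lemma free_L1_lower_bound:
  assumes "0 < \<kappa>" "\<rho> \<in> admissible" shows "- (\<kappa> / 2 * B) \<le> free_L1 \<kappa> \<rho>"
proof -
  have \<rho>: "prob_density (rep_circle_L1 \<rho>)" "finite_entropy (rep_circle_L1 \<rho>)"
    using assms(2) by (simp_all add: admissible_def)
  have "energy W (rep_circle_L1 \<rho>) \<le> B"
    using energy_bound[OF \<rho>(1)] by simp
  then have "\<kappa> / 2 * energy W (rep_circle_L1 \<rho>) \<le> \<kappa> / 2 * B"
    using assms(1) by (intro mult_left_mono) auto
  then show ?thesis
    using neg_entropy_nonneg[OF \<rho>] by linarith
qed

lemma bdd_below_free_L1: "0 < \<kappa> \<Longrightarrow> bdd_below (free_L1 \<kappa> ` admissible)"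
  using free_L1_lower_bound by (intro bdd_belowI2)

lemma min_energy_eq:
  assumes "0 < \<kappa>" shows "min_energy W \<kappa> = ereal (INF \<rho>\<in>admissible. free_L1 \<kappa> \<rho>)"
proof (rule antisym)
  show "ereal (INF \<rho>\<in>admissible. free_L1 \<kappa> \<rho>) \<le> min_energy W \<kappa>"
    unfolding min_energy_def
  proof (rule INF_greatest)
    fix \<rho> assume "\<rho> \<in> pos_densities"
    then show "ereal (INF \<rho>\<in>admissible. free_L1 \<kappa> \<rho>) \<le> free_energy W \<rho> \<kappa>"
      using bdd_below_free_L1[OF assms] by (auto simp: free_energy_eq intro: cINF_lower)
  qed
  have le: "min_energy W \<kappa> \<le> ereal (free_L1 \<kappa> \<rho>)" if "\<rho> \<in> admissible" for \<rho>
  proof -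
    have "\<rho> \<in> pos_densities"
      using that admissible_subset by blast
    then have "min_energy W \<kappa> \<le> free_energy W \<rho> \<kappa>"
      unfolding min_energy_def by (rule INF_lower)
    then show ?thesis
      using that \<open>\<rho> \<in> pos_densities\<close> by (simp add: free_energy_eq)
  qed
  obtain \<rho>1 where "\<rho>1 \<in> admissible"
    using admissible_nonempty by blast
  show "min_energy W \<kappa> \<le> ereal (INF \<rho>\<in>admissible. free_L1 \<kappa> \<rho>)"
  proof (cases "min_energy W \<kappa>")
    case (real x)
    then have "x \<le> (INF \<rho>\<in>admissible. free_L1 \<kappa> \<rho>)"
      using le admissible_nonempty by (intro cINF_greatest) auto
    then show ?thesis
      using real by simp
  next
    case PInf
    then show ?thesis
      using le[OF \<open>\<rho>1 \<in> admissible\<close>] by simp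
  qed simp
qed

lemma mem_minimizers_iff:
  assumes "0 < \<kappa>"
  shows "\<rho> \<in> minimizers W \<kappa> \<longleftrightarrow> \<rho> \<in> admissible \<and> (\<forall>\<sigma>\<in>admissible. free_L1 \<kappa> \<rho> \<le> free_L1 \<kappa> \<sigma>)"
proof -
  have "\<rho> \<in> minimizers W \<kappa> \<longleftrightarrow> \<rho> \<in> admissible \<and> free_L1 \<kappa> \<rho> = (INF \<rho>\<in>admissible. free_L1 \<kappa> \<rho>)"
    using admissible_subset free_energy_eq[of \<rho> \<kappa>] min_energy_eq[OF assms]
    by (auto simp: minimizers_def split: if_splits)
  also have "\<dots> \<longleftrightarrow> \<rho> \<in> admissible \<and> (\<forall>\<sigma>\<in>admissible. free_L1 \<kappa> \<rho> \<le> free_L1 \<kappa> \<sigma>)"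
  proof (intro conj_cong refl iffI ballI)
    fix \<sigma> assume "free_L1 \<kappa> \<rho> = (INF \<rho>\<in>admissible. free_L1 \<kappa> \<rho>)" "\<sigma> \<in> admissible"
    then show "free_L1 \<kappa> \<rho> \<le> free_L1 \<kappa> \<sigma>"
      using cINF_lower[OF bdd_below_free_L1[OF assms]] by simp
  next
    assume "\<rho> \<in> admissible" "\<forall>\<sigma>\<in>admissible. free_L1 \<kappa> \<rho> \<le> free_L1 \<kappa> \<sigma>"
    then show "free_L1 \<kappa> \<rho> = (INF \<rho>\<in>admissible. free_L1 \<kappa> \<rho>)"
      using admissible_nonempty
      by (intro antisym cINF_greatest cINF_lower[OF bdd_below_free_L1[OF assms]]) auto
  qed
  finally show ?thesis .
qed

lemma near_minimizers_L1_precompact: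
  assumes \<kappa>: "\<And>n. 0 < \<kappa>s n" "0 < \<kappa>" "\<kappa>s \<longlonglongrightarrow> \<kappa>" and \<rho>s: "\<And>n. \<rho>s n \<in> admissible"
    and near_min: "\<And>n \<sigma>. \<sigma> \<in> admissible \<Longrightarrow>
      free_L1 (\<kappa>s n) (\<rho>s n) \<le> free_L1 (\<kappa>s n) \<sigma> + (inverse (real (Suc n)))\<^sup>2"
  obtains r \<rho> where "strict_mono (r :: nat \<Rightarrow> nat)" "\<rho> \<in> minimizers W \<kappa>" "(\<lambda>n. \<rho>s (r n)) \<longlonglongrightarrow> \<rho>"
    "(\<lambda>n. interaction_energy W (\<rho>s (r n))) \<longlonglongrightarrow> interaction_energy W \<rho>"
proof -
  define fs where "fs n = rep_circle_L1 (\<rho>s n)" for n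
  have fs: "\<And>n. prob_density (fs n)" "\<And>n. finite_entropy (fs n)"
    using \<rho>s by (simp_all add: admissible_def fs_def)
  have near: "free (\<kappa>s n) (fs n) \<le> free (\<kappa>s n) g + (inverse (real (Suc n)))\<^sup>2"
    if g: "prob_density g" "finite_entropy g" for n g
  proof -
    obtain \<tau> where \<tau>: "\<tau> \<in> admissible" "AE \<theta> in circle. rep_circle_L1 \<tau> \<theta> = g \<theta>"
        "neg_entropy (rep_circle_L1 \<tau>) = neg_entropy g"
      using admissible_class_exists[OF g] .
    then have "energy W (rep_circle_L1 \<tau>) = energy W g"
      using g by (intro energy_cong_AE) (auto simp: admissible_def)
    then show ?thesis
      using near_min[OF \<tau>(1), of n] \<tau>(3) by (simp add: fs_def)
  qed
  have t: "0 < inverse (real (Suc n))" "inverse (real (Suc n)) \<le> 1" for n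
    by (simp_all add: field_simps)
  obtain r f where r: "strict_mono (r :: nat \<Rightarrow> nat)" and f: "prob_density f" "finite_entropy f"
    and L1: "(\<lambda>n. LINT \<theta>|circle. \<bar>fs (r n) \<theta> - f \<theta>\<bar>) \<longlonglongrightarrow> 0"
    and E: "(\<lambda>n. energy W (fs (r n))) \<longlonglongrightarrow> energy W f"
    and min: "\<forall>g. prob_density g \<and> finite_entropy g \<longrightarrow> free \<kappa> f \<le> free \<kappa> g"
    using near_minimizers_precompact[of \<kappa>s \<kappa> fs "\<lambda>n. inverse (real (Suc n))",
        OF \<kappa>(1,3) fs t LIMSEQ_inverse_real_of_nat near] .
  obtain \<rho> where \<rho>: "\<rho> \<in> admissible" and eq: "AE \<theta> in circle. rep_circle_L1 \<rho> \<theta> = f \<theta>"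
      and entropy: "neg_entropy (rep_circle_L1 \<rho>) = neg_entropy f"
    using admissible_class_exists[OF f] .
  have energy: "energy W (rep_circle_L1 \<rho>) = energy W f"
    using \<rho> f eq by (intro energy_cong_AE) (auto simp: admissible_def)
  show ?thesis
  proof (rule that[OF r])
    show "\<rho> \<in> minimizers W \<kappa>"
      unfolding mem_minimizers_iff[OF \<kappa>(2)] using \<rho> min
      by (auto simp: entropy energy admissible_def)
    show "(\<lambda>n. interaction_energy W (\<rho>s (r n))) \<longlonglongrightarrow> interaction_energy W \<rho>"
      using E by (simp add: interaction_energy_eq energy fs_def)
    have "dist (\<rho>s n) \<rho> = (LINT \<theta>|circle. \<bar>fs n \<theta> - f \<theta>\<bar>)" for n
      unfolding dist_L1_rep fs_def
    proof (rule integral_cong_AE)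
      show "AE \<theta> in circle. \<bar>rep_circle_L1 (\<rho>s n) \<theta> - rep_circle_L1 \<rho> \<theta>\<bar> = \<bar>rep_circle_L1 (\<rho>s n) \<theta> - f \<theta>\<bar>"
        using eq by eventually_elim simp
    qed (use prob_density_measurable[OF f(1)] borel_measurable_integrable[OF integrable_rep_L1] in simp_all)
    with L1 show "(\<lambda>n. \<rho>s (r n)) \<longlonglongrightarrow> \<rho>"
      by (subst tendsto_dist_iff) simp
  qed
qed

lemma minimizers_closed:
  assumes "\<And>n. 0 < \<kappa>s n" "0 < \<kappa>" "\<kappa>s \<longlonglongrightarrow> \<kappa>" "\<And>n. \<rho>s n \<in> minimizers W (\<kappa>s n)"
  obtains r \<rho> where "strict_mono (r :: nat \<Rightarrow> nat)" "\<rho> \<in> minimizers W \<kappa>" "(\<lambda>n. \<rho>s (r n)) \<longlonglongrightarrow> \<rho>"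
    "(\<lambda>n. interaction_energy W (\<rho>s (r n))) \<longlonglongrightarrow> interaction_energy W \<rho>"
proof (rule near_minimizers_L1_precompact[OF assms(1-3)])
  have min: "\<rho>s n \<in> admissible \<and> (\<forall>\<sigma>\<in>admissible. free_L1 (\<kappa>s n) (\<rho>s n) \<le> free_L1 (\<kappa>s n) \<sigma>)" for n
    using mem_minimizers_iff[OF assms(1)] assms(4) by blast
  show "\<rho>s n \<in> admissible" for n
    using min ..
  show "free_L1 (\<kappa>s n) (\<rho>s n) \<le> free_L1 (\<kappa>s n) \<sigma> + (inverse (real (Suc n)))\<^sup>2"
    if "\<sigma> \<in> admissible" for n \<sigma>
  proof -
    have "free_L1 (\<kappa>s n) (\<rho>s n) \<le> free_L1 (\<kappa>s n) \<sigma>"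
      using min that by blast
    then show ?thesis
      by (rule add_increasing2[rotated]) simp
  qed
qed (rule that)

text \<open>The direct method: a sequence that minimizes up to \<open>1 / (n + 1)\<^sup>2\<close> at a fixed parameter.\<close>

lemma minimizers_nonempty:
  assumes "0 < \<kappa>" shows "minimizers W \<kappa> \<noteq> {}"
proof -
  let ?m = "INF \<rho>\<in>admissible. free_L1 \<kappa> \<rho>"
  have "\<exists>\<rho>. \<rho> \<in> admissible \<and> free_L1 \<kappa> \<rho> < ?m + (inverse (real (Suc n)))\<^sup>2" for n
  proof -
    have "?m < ?m + (inverse (real (Suc n)))\<^sup>2"
      by simp
    from cInf_lessD[OF _ this] admissible_nonempty show ?thesis
      by blast
  qed
  then have "\<forall>n. \<exists>\<rho>. \<rho> \<in> admissible \<and> free_L1 \<kappa> \<rho> < ?m + (inverse (real (Suc n)))\<^sup>2" ..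
  from choice[OF this] obtain \<rho>s where \<rho>s: "\<And>n. \<rho>s n \<in> admissible"
      "\<And>n. free_L1 \<kappa> (\<rho>s n) < ?m + (inverse (real (Suc n)))\<^sup>2"
    by blast
  have near: "free_L1 \<kappa> (\<rho>s n) \<le> free_L1 \<kappa> \<sigma> + (inverse (real (Suc n)))\<^sup>2" if "\<sigma> \<in> admissible" for n \<sigma>
  proof -
    have "?m \<le> free_L1 \<kappa> \<sigma>"
      using that by (rule cINF_lower[OF bdd_below_free_L1[OF assms]])
    then show ?thesis
      using \<rho>s(2)[of n] by linarith
  qed
  show ?thesis
    using near_minimizers_L1_precompact[of "\<lambda>_. \<kappa>", OF assms assms tendsto_const \<rho>s(1) near] by blast
qed

lemma compact_minimizers:
  assumes "0 < \<kappa>" shows "compact (minimizers W \<kappa>)"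
  unfolding compact_eq_seq_compact_metric seq_compact_def
proof (intro allI impI)
  fix \<rho>s :: "nat \<Rightarrow> circle_L1" assume "\<forall>n. \<rho>s n \<in> minimizers W \<kappa>"
  then have mem: "\<rho>s n \<in> minimizers W \<kappa>" for n
    by blast
  obtain r \<rho> where "strict_mono (r :: nat \<Rightarrow> nat)" "\<rho> \<in> minimizers W \<kappa>" "(\<lambda>n. \<rho>s (r n)) \<longlonglongrightarrow> \<rho>"
    using minimizers_closed[of "\<lambda>_. \<kappa>", OF assms assms tendsto_const mem] .
  then show "\<exists>\<rho>\<in>minimizers W \<kappa>. \<exists>r. strict_mono r \<and> (\<rho>s \<circ> r) \<longlonglongrightarrow> \<rho>"
    by (auto simp: o_def)
qed

sublocale parametric_minimization admissible "\<lambda>\<rho>. neg_entropy (rep_circle_L1 \<rho>)"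
  "interaction_energy W" B "\<lambda>\<kappa>. real_of_ereal (min_energy W \<kappa>)" "minimizers W"
proof
  show "\<bar>interaction_energy W \<rho>\<bar> \<le> B" if "\<rho> \<in> admissible" for \<rho>
    using that energy_bound by (simp add: interaction_energy_eq admissible_def)
  show "minimizers W \<kappa> \<subseteq> admissible" if "0 < \<kappa>" for \<kappa>
    using mem_minimizers_iff[OF that] by blast
  show le: "real_of_ereal (min_energy W \<kappa>) \<le> neg_entropy (rep_circle_L1 \<rho>) - \<kappa> / 2 * interaction_energy W \<rho>"
    if "0 < \<kappa>" "\<rho> \<in> admissible" for \<kappa> \<rho>
    using cINF_lower[OF bdd_below_free_L1[OF that(1)] that(2)]
    by (simp add: min_energy_eq[OF that(1)] interaction_energy_eq)
  show "real_of_ereal (min_energy W \<kappa>) = neg_entropy (rep_circle_L1 \<rho>) - \<kappa> / 2 * interaction_energy W \<rho>"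
    if "0 < \<kappa>" "\<rho> \<in> minimizers W \<kappa>" for \<kappa> \<rho>
  proof -
    have \<rho>: "\<rho> \<in> pos_densities" "\<rho> \<in> admissible" "free_energy W \<rho> \<kappa> = min_energy W \<kappa>"
      using that mem_minimizers_iff[OF that(1)] by (auto simp: minimizers_def)
    then have "min_energy W \<kappa> = ereal (free_L1 \<kappa> \<rho>)"
      using free_energy_eq[OF \<rho>(1)] by simp
    then show ?thesis
      by (simp add: interaction_energy_eq)
  qed
  show "\<exists>r \<rho>0. strict_mono (r :: nat \<Rightarrow> nat) \<and> \<rho>0 \<in> minimizers W \<kappa>0 \<and>
      (\<lambda>j. interaction_energy W (\<rho>s (r j))) \<longlonglongrightarrow> interaction_energy W \<rho>0"
    if "\<And>n. 0 < \<kappa>s n" "0 < \<kappa>0" "\<kappa>s \<longlonglongrightarrow> \<kappa>0" "\<And>n. \<rho>s n \<in> minimizers W (\<kappa>s n)" for \<kappa>s \<kappa>0 \<rho>s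
    using minimizers_closed[OF that] by metis
qed (rule minimizers_nonempty)

end

theorem theorem3p3:
  fixes W :: "real \<Rightarrow> real" and a :: "nat \<Rightarrow> real"
  assumes periodic: "\<And>\<theta>. W (\<theta> + 2 * pi) = W \<theta>"
    and even: "\<And>\<theta>. W (- \<theta>) = W \<theta>"
    and square_integrable: "integrable circle (\<lambda>\<theta>. (W \<theta>)\<^sup>2)"
    and fourier: "(\<lambda>N. LINT \<theta>|circle. (W \<theta> - (\<Sum>l = 1..N. a l * cos (real l * \<theta>)))\<^sup>2)
      \<longlonglongrightarrow> 0"
    and continuous: "continuous_on UNIV W"
    and bounded: "bounded (range W)"
  shows
    "(\<forall>\<kappa>>0. minimizers W \<kappa> \<noteq> {} \<and> compact (minimizers W \<kappa>))
     \<and> (\<forall>\<kappa>s \<kappa>0 \<rho>s. (\<forall>n. 0 < \<kappa>s n) \<longrightarrow> 0 < \<kappa>0 \<longrightarrow> \<kappa>s \<longlonglongrightarrow> \<kappa>0 \<longrightarrow>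
          (\<forall>n. \<rho>s n \<in> minimizers W (\<kappa>s n)) \<longrightarrow>
          (\<exists>r \<rho>0. strict_mono (r :: nat \<Rightarrow> nat) \<and> \<rho>0 \<in> minimizers W \<kappa>0 \<and>
             (\<lambda>j. \<rho>s (r j)) \<longlonglongrightarrow> \<rho>0))
     \<and> (\<forall>\<kappa>>0. \<bar>min_energy W \<kappa>\<bar> \<noteq> \<infinity>)
     \<and> concave_on {0<..} (\<lambda>\<kappa>. real_of_ereal (min_energy W \<kappa>))
     \<and> (\<exists>L. L-lipschitz_on {0<..} (\<lambda>\<kappa>. real_of_ereal (min_energy W \<kappa>)))
     \<and> (\<forall>\<kappa>>0.
          ((\<lambda>\<kappa>. real_of_ereal (min_energy W \<kappa>)) has_real_derivative
             - (1 / 2) * (INF \<rho>\<in>minimizers W \<kappa>. interaction_energy W \<rho>)) (at_left \<kappa>)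
        \<and> ((\<lambda>\<kappa>. real_of_ereal (min_energy W \<kappa>)) has_real_derivative
             - (1 / 2) * (SUP \<rho>\<in>minimizers W \<kappa>. interaction_energy W \<rho>)) (at_right \<kappa>))
     \<and> mono_on {0<..} (\<lambda>\<kappa>. INF \<rho>\<in>minimizers W \<kappa>. interaction_energy W \<rho>)
     \<and> mono_on {0<..} (\<lambda>\<kappa>. SUP \<rho>\<in>minimizers W \<kappa>. interaction_energy W \<rho>)
     \<and> countable {\<kappa> \<in> {0<..}. \<not> (\<lambda>\<kappa>. real_of_ereal (min_energy W \<kappa>)) differentiable (at \<kappa>)}
     \<and> (\<forall>\<kappa>>0. \<not> (\<lambda>\<kappa>. real_of_ereal (min_energy W \<kappa>)) differentiable (at \<kappa>) \<longrightarrow>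
          (\<exists>\<rho>1\<in>minimizers W \<kappa>. \<exists>\<rho>2\<in>minimizers W \<kappa>.
             \<rho>1 \<noteq> \<rho>2 \<and> interaction_energy W \<rho>1 \<noteq> interaction_energy W \<rho>2))"
proof -
  obtain B where "\<And>\<theta>. \<bar>W \<theta>\<bar> \<le> B"
    using bounded by (auto simp: bounded_iff)
  then interpret interaction_kernel W B
    using even continuous by unfold_locales
  show ?thesis
  proof (intro conjI)
    show "\<forall>\<kappa>>0. minimizers W \<kappa> \<noteq> {} \<and> compact (minimizers W \<kappa>)"
      using minimizers_nonempty compact_minimizers by blast
    show "\<forall>\<kappa>s \<kappa>0 \<rho>s. (\<forall>n. 0 < \<kappa>s n) \<longrightarrow> 0 < \<kappa>0 \<longrightarrow> \<kappa>s \<longlonglongrightarrow> \<kappa>0 \<longrightarrow>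
        (\<forall>n. \<rho>s n \<in> minimizers W (\<kappa>s n)) \<longrightarrow>
        (\<exists>r \<rho>0. strict_mono (r :: nat \<Rightarrow> nat) \<and> \<rho>0 \<in> minimizers W \<kappa>0 \<and> (\<lambda>j. \<rho>s (r j)) \<longlonglongrightarrow> \<rho>0)"
    proof (intro allI impI)
      fix \<kappa>s \<kappa>0 \<rho>s
      assume "\<forall>n. 0 < \<kappa>s n" "0 < \<kappa>0" "\<kappa>s \<longlonglongrightarrow> \<kappa>0" "\<forall>n. \<rho>s n \<in> minimizers W (\<kappa>s n)"
      then show "\<exists>r \<rho>0. strict_mono (r :: nat \<Rightarrow> nat) \<and> \<rho>0 \<in> minimizers W \<kappa>0 \<and> (\<lambda>j. \<rho>s (r j)) \<longlonglongrightarrow> \<rho>0"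
        using minimizers_closed[of \<kappa>s \<kappa>0 \<rho>s] by metis
    qed
    show "\<forall>\<kappa>>0. \<bar>min_energy W \<kappa>\<bar> \<noteq> \<infinity>"
      by (simp add: min_energy_eq)
    show "\<exists>L. L-lipschitz_on {0<..} (\<lambda>\<kappa>. real_of_ereal (min_energy W \<kappa>))"
      using lipschitz_m ..
    show "\<forall>\<kappa>>0. \<not> (\<lambda>\<kappa>. real_of_ereal (min_energy W \<kappa>)) differentiable (at \<kappa>) \<longrightarrow>
        (\<exists>\<rho>1\<in>minimizers W \<kappa>. \<exists>\<rho>2\<in>minimizers W \<kappa>.
          \<rho>1 \<noteq> \<rho>2 \<and> interaction_energy W \<rho>1 \<noteq> interaction_energy W \<rho>2)"
      using two_energies_if_not_differentiable by metis
  qed (use concave_m left_derivative_m right_derivative_m mono_E_min mono_E_max countable_kinks in \<open>simp_all\<close>)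
qed

end
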